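(* Let $\{X_t : t\in\mathbb{Z}\}$ be a real-valued, zero mean, weakly stationary time series on a probability space $(\Omega,\mathcal{F},P)$ with autocovariance function $c(r)=\mathrm{cov}(X_0,X_{-r})$ and spectral density $f(\omega)=\sum_{r\in\mathbb{Z}}c(r)e^{ir\omega}$ satisfying $0<\inf_\omega f(\omega)\le \sup_\omega f(\omega)<\infty$. Let $\sigma^2$, $\phi_j$, $\psi_j$, $\phi(\cdot)$, $\psi(\cdot)$ be the quantities in the spectral factorization $f(\omega)=\sigma^2|\psi(\omega)|^2=\sigma^2|\phi(\omega)|^{-2}$ described in the context, and for $\ell\ge 0$ let $\phi_\ell(\omega)=\sum_{s=1}^{\infty}\phi_{\ell+s}e^{is\omega}$. Let $Y\in L_2(\Omega,\mathcal{F},P)$ be real-valued, let $c_{YX}(\ell)=\mathrm{cov}(Y,X_{-\ell})$ for $\ell\ge0$, and let $$P_{\mathcal{H}_0}(Y)=\sum_{j=0}^{\infty}h_jX_{-j}$$ be the orthogonal projection of $Y$ onto $\mathcal{H}_0$. Then $(h_j; j\ge 0)'\in\ell_2^+$, $(c_{YX}(\ell);\ell\ge 0)'\in\ell_2^+$, and $H(\omega)=\sum_{j=0}^{\infty}h_je^{ij\omega}$ satisfies $$H(\omega)=\frac{\sum_{\ell=0}^{\infty}c_{YX}(\ell)\big(e^{i\ell\omega}+\psi(\omega)^*\phi_\ell(\omega)^*\big)}{f(\omega)}.$$ This can alternatively be expressed as $$H(\omega)=\sigma^{-2}\phi(\omega)\sum_{\ell=0}^{\infty}c_{YX}(\ell)\Big(e^{i\ell\omega}-\sum_{s=1}^{\ell}\phi_se^{i(\ell-s)\omega}\Big),$$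 where for $\ell=0$ the inner sum $\sum_{s=1}^{0}$ is $0$.
   Context: $\mathcal{H}_0$ is the closed linear span of $\{X_j: j\le 0\}$ in the real Hilbert space $L_2(\Omega,\mathcal{F},P)$, and $P_{\mathcal{H}_0}$ is the orthogonal projection onto it. $\ell_2^+$ is the space of square-summable sequences $(v_0,v_1,\ldots)'$. The superscript $*$ denotes complex conjugation. Spectral factorization: if $0<\inf_\omega f\le\sup_\omega f<\infty$, there are unique $\sigma^2>0$ and real square-summable sequences $(\psi_j)_{j\ge1}$, $(\phi_j)_{j\ge1}$ such that $\Psi(z)=1+\sum_{j\ge1}\psi_jz^j$ and $\Phi(z)=1-\sum_{j\ge1}\phi_jz^j$ satisfy $\Psi(z)\Phi(z)=1$ for $|z|<1$, and, with $\psi(\omega)=1+\sum_{j\ge1}\psi_je^{ij\omega}$ and $\phi(\omega)=1-\sum_{j\ge1}\phi_je^{ij\omega}=\psi(\omega)^{-1}$, one has $f(\omega)=\sigma^2|\psi(\omega)|^2=\sigma^2|\phi(\omega)|^{-2}$. (These are the infinite-order MA and AR coefficients of the Wold-type representations $X_t=\varepsilon_t+\sum_{j\ge1}\psi_j\varepsilon_{t-j}$ and $X_t-\sum_{j\ge1}\phi_jX_{t-j}=\varepsilon_t$, where $\{\varepsilon_t\}$ is white noise with variance $\sigma^2$ and $\varepsilon_t$ is orthogonal to the closed span of $\{X_j:j\le t-1\}$.) Fourier series with square-summable coefficients are understood as elements of $L_2([0,2\pi))$; series of functions of $\omega$ converge in $L_2([0,2\pi))$ and identities between functions of $\omega$ are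 identities in $L_2([0,2\pi))$ (i.e. for almost every $\omega$). *)

theory Defs
  imports "HOL-Probability.Probability"
begin

text \<open>
  Elements of \<open>L\<^sub>2\<close> are represented by functions, taken up to equality almost everywhere.
\<close>

definition square_integrable :: "'a measure \<Rightarrow> ('a \<Rightarrow> 'b::real_normed_vector) \<Rightarrow> bool" where
  "square_integrable M g \<longleftrightarrow> g \<in> borel_measurable M \<and> integrable M (\<lambda>x. (norm (g x))\<^sup>2)"

definition L2_lim :: "'a measure \<Rightarrow> (nat \<Rightarrow> 'a \<Rightarrow> 'b::real_normed_vector) \<Rightarrow> ('a \<Rightarrow> 'b) \<Rightarrow> bool" where
  "L2_lim M S g \<longleftrightarrow>
     (\<forall>n. square_integrable M (S n)) \<and> square_integrable M g \<and>
     (\<lambda>n. \<integral>x. (norm (S n x - g x))\<^sup>2 \<partial>M) \<longlonglongrightarrow> 0"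

abbreviation circ :: "real measure" where
  "circ \<equiv> lebesgue_on {0..<2*pi}"

definition covariance :: "'a measure \<Rightarrow> ('a \<Rightarrow> real) \<Rightarrow> ('a \<Rightarrow> real) \<Rightarrow> real" where
  "covariance M U V = (\<integral>x. (U x - (\<integral>y. U y \<partial>M)) * (V x - (\<integral>y. V y \<partial>M)) \<partial>M)"

definition zero_mean_weakly_stationary :: "'a measure \<Rightarrow> (int \<Rightarrow> 'a \<Rightarrow> real) \<Rightarrow> bool" where
  "zero_mean_weakly_stationary M X \<longleftrightarrow>
     (\<forall>t. square_integrable M (X t)) \<and>
     (\<forall>t. (\<integral>x. X t x \<partial>M) = 0) \<and>
     (\<forall>t r. covariance M (X t) (X (t - r)) = covariance M (X 0) (X (- r)))"

definition autocov :: "'a measure \<Rightarrow> (int \<Rightarrow> 'a \<Rightarrow> real) \<Rightarrow> int \<Rightarrow> real" where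
  "autocov M X r = covariance M (X 0) (X (- r))"

definition spectral_density :: "'a measure \<Rightarrow> (int \<Rightarrow> 'a \<Rightarrow> real) \<Rightarrow> (real \<Rightarrow> real) \<Rightarrow> bool" where
  "spectral_density M X f \<longleftrightarrow>
     L2_lim circ
       (\<lambda>n \<omega>. \<Sum>r\<in>{- int n..int n}. complex_of_real (autocov M X r) * cis (of_int r * \<omega>))
       (\<lambda>\<omega>. complex_of_real (f \<omega>))"

text \<open>
  The infimum and supremum of a function on the circle are essential ones, since the function
  is only determined almost everywhere.
\<close>

definition bounded_away_from_zero_and_infinity :: "(real \<Rightarrow> real) \<Rightarrow> bool" where
  "bounded_away_from_zero_and_infinity f \<longleftrightarrow>
     (\<exists>m K. 0 < m \<and> (AE \<omega> in circ. m \<le> f \<omega> \<and> f \<omega> \<le> K))"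

text \<open>
  Here \<open>\<psi>\<close>, \<open>\<phi>\<close> are the coefficient sequences (their values at index \<open>0\<close> are never used)
  and \<open>\<psi>f\<close>, \<open>\<phi>f\<close> are the corresponding functions of \<open>\<omega>\<close>.
\<close>

definition spectral_factorization ::
  "(real \<Rightarrow> real) \<Rightarrow> real \<Rightarrow> (nat \<Rightarrow> real) \<Rightarrow> (nat \<Rightarrow> real) \<Rightarrow>
   (real \<Rightarrow> complex) \<Rightarrow> (real \<Rightarrow> complex) \<Rightarrow> bool" where
  "spectral_factorization f \<sigma>2 \<psi> \<phi> \<psi>f \<phi>f \<longleftrightarrow>
     0 < \<sigma>2 \<and>
     summable (\<lambda>j. (\<psi> (Suc j))\<^sup>2) \<and> summable (\<lambda>j. (\<phi> (Suc j))\<^sup>2) \<and>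
     (\<forall>z::complex. norm z < 1 \<longrightarrow>
        (1 + (\<Sum>j. complex_of_real (\<psi> (Suc j)) * z ^ Suc j)) *
        (1 - (\<Sum>j. complex_of_real (\<phi> (Suc j)) * z ^ Suc j)) = 1) \<and>
     L2_lim circ (\<lambda>n \<omega>. 1 + (\<Sum>j=1..n. complex_of_real (\<psi> j) * cis (real j * \<omega>))) \<psi>f \<and>
     L2_lim circ (\<lambda>n \<omega>. 1 - (\<Sum>j=1..n. complex_of_real (\<phi> j) * cis (real j * \<omega>))) \<phi>f \<and>
     (AE \<omega> in circ. \<phi>f \<omega> = inverse (\<psi>f \<omega>)) \<and>
     (AE \<omega> in circ. f \<omega> = \<sigma>2 * (norm (\<psi>f \<omega>))\<^sup>2) \<and>
     (AE \<omega> in circ. f \<omega> = \<sigma>2 / (norm (\<phi>f \<omega>))\<^sup>2)"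

text \<open>The closed linear span of \<open>X j\<close>, \<open>j \<le> 0\<close>, in \<open>L\<^sub>2\<close>.\<close>

definition past_space :: "'a measure \<Rightarrow> (int \<Rightarrow> 'a \<Rightarrow> real) \<Rightarrow> ('a \<Rightarrow> real) set" where
  "past_space M X =
     {Z. square_integrable M Z \<and>
         (\<forall>e>0. \<exists>J a. finite J \<and> J \<subseteq> {..0} \<and>
            (\<integral>x. (Z x - (\<Sum>j\<in>J. a j * X j x))\<^sup>2 \<partial>M) < e)}"

definition orthogonal_projection ::
  "'a measure \<Rightarrow> ('a \<Rightarrow> real) set \<Rightarrow> ('a \<Rightarrow> real) \<Rightarrow> ('a \<Rightarrow> real) \<Rightarrow> bool" where
  "orthogonal_projection M H Y Z \<longleftrightarrow>
     Z \<in> H \<and> (\<forall>W\<in>H. (\<integral>x. (Y x - Z x) * W x \<partial>M) = 0)"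

end

theory Submission
  imports Defs
begin

text \<open>
  Since \<open>f\<close> is bounded above and away from zero, \<open>X\<^sub>-\<^sub>j \<mapsto> exp (i j \<omega>)\<close> turns the closed span of the past into the
  closure of the analytic trigonometric polynomials (the Hardy space), and square summable
  coefficients correspond to elements of both. The normal equations say that \<open>f H\<close> has the Fourier
  coefficients \<open>c\<^sub>Y\<^sub>X(k)\<close> for \<open>k \<ge> 0\<close>. Multiplying by the conjugate of \<open>\<phi>\<close> turns \<open>f H\<close> into
  \<open>\<sigma>\<^sup>2 \<psi> H\<close>, which is in the Hardy space, and changes its projection onto the Hardy space only through
  the nonnegative frequencies of \<open>f H\<close>, because the conjugate of \<open>\<phi>\<close> has no positive frequencies. So
  \<open>\<sigma>\<^sup>2 \<psi> H\<close> is the sum of \<open>c\<^sub>Y\<^sub>X(l)\<close> times the projection of \<open>exp (i l \<omega>)\<close> times the conjugate of \<open>\<phi>\<close>.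
  This is the second formula; multiplying by the conjugate of \<open>\<psi>\<close> gives the first one.
\<close>

section \<open>Square integrable functions\<close>

text \<open>Two obstacles shape the development. A product of two square integrable functions is in
  general only integrable; the bounds on \<open>f\<close> bound \<psi> by
  \<open>sqrt (K / \<sigma>2)\<close> and \<phi> by \<open>sqrt (\<sigma>2 / m)\<close>, so
  multiplication by either acts on square integrable functions. The series over \<open>l\<close> in
  the two formulas are not orthogonal expansions, so their convergence cannot be read off Parseval.
  It comes from the fact that projecting never increases a norm: the error after \<open>n\<close>
  terms is at most the bound of \<phi> times the tail of the Fourier series with coefficients
  \<open>cYX l\<close>. The first formula inherits convergence through the bounded conjugate of
  \<psi>. The correspondence between the past and the Hardy space is used only on finite sums and
  their limits, as a two-sided norm estimate with constants \<open>m\<close> and \<open>K\<close>.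
  Factors \<open>2 * pi\<close> arise because the measure on the circle is not normalised.\<close>

definition L2_norm :: "'a measure \<Rightarrow> ('a \<Rightarrow> 'b::real_normed_vector) \<Rightarrow> real" where
  "L2_norm M u = sqrt (\<integral>x. (norm (u x))\<^sup>2 \<partial>M)"

lemma L2_norm_nonneg [simp]: "0 \<le> L2_norm M u"
  by (simp add: L2_norm_def)

lemma L2_norm_square: "(L2_norm M u)\<^sup>2 = (\<integral>x. (norm (u x))\<^sup>2 \<partial>M)"
  by (simp add: L2_norm_def)

lemma L2_norm_minus_commute: "L2_norm M (\<lambda>x. u x - v x) = L2_norm M (\<lambda>x. v x - u x)"
  by (simp add: L2_norm_def norm_minus_commute)

lemma L2_norm_uminus [simp]: "L2_norm M (\<lambda>x. - u x) = L2_norm M u"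
  by (simp add: L2_norm_def)

lemma L2_norm_norm [simp]: "L2_norm M (\<lambda>x. norm (u x)) = L2_norm M u"
  by (simp add: L2_norm_def)

lemma L2_norm_cong_AE:
  assumes "u \<in> borel_measurable M" "v \<in> borel_measurable M" "AE x in M. u x = v x"
  shows "L2_norm M u = L2_norm M v"
proof -
  have "(\<integral>x. (norm (u x))\<^sup>2 \<partial>M) = (\<integral>x. (norm (v x))\<^sup>2 \<partial>M)"
    using assms by (intro integral_cong_AE) auto
  then show ?thesis by (simp add: L2_norm_def)
qed

lemma square_integrable_measurable [measurable_dest]:
  "square_integrable M u \<Longrightarrow> u \<in> borel_measurable M"
  by (simp add: square_integrable_def)

lemma square_integrable_norm: "square_integrable M u \<Longrightarrow> square_integrable M (\<lambda>x. norm (u x))"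
  by (auto simp: square_integrable_def)

lemma square_integrable_cnj:
  fixes u :: "'a \<Rightarrow> complex"
  shows "square_integrable M u \<Longrightarrow> square_integrable M (\<lambda>x. cnj (u x))"
  using measurable_compose[of u M borel cnj borel] borel_measurable_continuous_onI[of cnj]
  by (auto simp: square_integrable_def continuous_on_cnj)

lemma square_integrable_zero [simp]: "square_integrable M (\<lambda>x. 0)"
  by (simp add: square_integrable_def)

lemma square_integrable_uminus:
  fixes u :: "'a \<Rightarrow> 'b::{second_countable_topology, real_normed_vector}"
  shows "square_integrable M u \<Longrightarrow> square_integrable M (\<lambda>x. - u x)"
  by (simp add: square_integrable_def)

lemma square_integrable_add:
  fixes u v :: "'a \<Rightarrow> 'b::{second_countable_topology, real_normed_vector}"
  assumes "square_integrable M u" "square_integrable M v"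
  shows "square_integrable M (\<lambda>x. u x + v x)"
proof -
  have m [measurable]: "u \<in> borel_measurable M" "v \<in> borel_measurable M"
    using assms by (simp_all add: square_integrable_def)
  have i: "integrable M (\<lambda>x. 2 * (norm (u x))\<^sup>2 + 2 * (norm (v x))\<^sup>2)"
    using assms by (simp add: square_integrable_def)
  have "(norm (u x + v x))\<^sup>2 \<le> 2 * (norm (u x))\<^sup>2 + 2 * (norm (v x))\<^sup>2" for x
  proof -
    have "(norm (u x + v x))\<^sup>2 \<le> (norm (u x) + norm (v x))\<^sup>2"
      by (simp add: norm_triangle_ineq power_mono)
    also have "\<dots> \<le> 2 * (norm (u x))\<^sup>2 + 2 * (norm (v x))\<^sup>2"
      using sum_squares_bound[of "norm (u x)" "norm (v x)"] by (simp add: power2_sum)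
    finally show ?thesis .
  qed
  then have "integrable M (\<lambda>x. (norm (u x + v x))\<^sup>2)"
    by (intro Bochner_Integration.integrable_bound[OF i]) auto
  then show ?thesis by (simp add: square_integrable_def)
qed

lemma square_integrable_diff:
  fixes u v :: "'a \<Rightarrow> 'b::{second_countable_topology, real_normed_vector}"
  assumes "square_integrable M u" "square_integrable M v"
  shows "square_integrable M (\<lambda>x. u x - v x)"
  using square_integrable_add[OF assms(1) square_integrable_uminus[OF assms(2)]] by simp

lemma square_integrable_sum:
  fixes u :: "'i \<Rightarrow> 'a \<Rightarrow> 'b::{second_countable_topology, real_normed_vector}"
  assumes "\<And>i. i \<in> I \<Longrightarrow> square_integrable M (u i)"
  shows "square_integrable M (\<lambda>x. \<Sum>i\<in>I. u i x)"
  using assms by (induction I rule: infinite_finite_induct) (auto intro: square_integrable_add)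

text \<open>Boundedness of one factor keeps a product square integrable. Characters, the density and
  the spectral factors all enter as such multipliers; an almost everywhere bound is all that is
  known of the last two.\<close>

lemma square_integrable_bounded_mult:
  fixes u b :: "'a \<Rightarrow> 'b::{second_countable_topology, real_normed_field}"
  assumes u: "square_integrable M u" and b [measurable]: "b \<in> borel_measurable M"
    and bB: "AE x in M. norm (b x) \<le> B" and B: "0 \<le> B"
  shows "square_integrable M (\<lambda>x. b x * u x)" "L2_norm M (\<lambda>x. b x * u x) \<le> B * L2_norm M u"
proof -
  have m [measurable]: "u \<in> borel_measurable M" and i: "integrable M (\<lambda>x. (norm (u x))\<^sup>2)"
    using u by (simp_all add: square_integrable_def)
  have AE: "AE x in M. (norm (b x * u x))\<^sup>2 \<le> B\<^sup>2 * (norm (u x))\<^sup>2"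
    using bB by eventually_elim (simp add: norm_mult power_mult_distrib mult_right_mono power_mono)
  have int: "integrable M (\<lambda>x. (norm (b x * u x))\<^sup>2)"
    by (rule Bochner_Integration.integrable_bound[where f = "\<lambda>x. B\<^sup>2 * (norm (u x))\<^sup>2"])
       (use i AE in auto)
  then show "square_integrable M (\<lambda>x. b x * u x)"
    by (simp add: square_integrable_def)
  have "(\<integral>x. (norm (b x * u x))\<^sup>2 \<partial>M) \<le> (\<integral>x. B\<^sup>2 * (norm (u x))\<^sup>2 \<partial>M)"
    using AE i int by (intro integral_mono_AE) auto
  then have "(L2_norm M (\<lambda>x. b x * u x))\<^sup>2 \<le> (B * L2_norm M u)\<^sup>2"
    by (simp add: L2_norm_square power_mult_distrib)
  then show "L2_norm M (\<lambda>x. b x * u x) \<le> B * L2_norm M u"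
    by (rule power2_le_imp_le) (simp add: B)
qed

lemma square_integrable_cmult:
  fixes u :: "'a \<Rightarrow> 'b::{second_countable_topology, real_normed_field}"
  shows "square_integrable M u \<Longrightarrow> square_integrable M (\<lambda>x. c * u x)"
  by (rule square_integrable_bounded_mult[where B = "norm c"]) auto

lemma square_integrable_imp_integrable_mult:
  fixes u v :: "'a \<Rightarrow> 'b::{second_countable_topology, real_normed_field, banach}"
  assumes "square_integrable M u" "square_integrable M v"
  shows "integrable M (\<lambda>x. u x * v x)"
proof -
  have m [measurable]: "u \<in> borel_measurable M" "v \<in> borel_measurable M"
    using assms by (simp_all add: square_integrable_def)
  have i: "integrable M (\<lambda>x. (norm (u x))\<^sup>2 + (norm (v x))\<^sup>2)"
    using assms by (simp add: square_integrable_def)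
  have "norm (u x * v x) \<le> (norm (u x))\<^sup>2 + (norm (v x))\<^sup>2" for x
  proof -
    have "0 \<le> norm (u x) * norm (v x)" by simp
    then show ?thesis
      using sum_squares_bound[of "norm (u x)" "norm (v x)"] unfolding norm_mult by linarith
  qed
  then show ?thesis
    by (intro Bochner_Integration.integrable_bound[OF i]) auto
qed

text \<open>The pairing is bilinear, without a conjugate, so that one statement serves real random
  variables and complex functions on the circle; inner products arise by putting \<open>cnj\<close>
  into the second factor.\<close>

lemma L2_Cauchy_Schwarz:
  fixes u v :: "'a \<Rightarrow> 'b::{second_countable_topology, real_normed_field, banach}"
  assumes "square_integrable M u" "square_integrable M v"
  shows "norm (\<integral>x. u x * v x \<partial>M) \<le> L2_norm M u * L2_norm M v"
proof -
  let ?I = "\<integral>x. norm (u x) * norm (v x) \<partial>M"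
  have m [measurable]: "u \<in> borel_measurable M" "v \<in> borel_measurable M"
    using assms by (simp_all add: square_integrable_def)
  have i: "integrable M (\<lambda>x. norm (u x) * norm (v x))"
    using integrable_norm[OF square_integrable_imp_integrable_mult[OF assms]] by (simp add: norm_mult)
  have "(\<integral>\<^sup>+x. ennreal (norm (u x)) * ennreal (norm (v x)) \<partial>M)\<^sup>2
      \<le> (\<integral>\<^sup>+x. (ennreal (norm (u x)))\<^sup>2 \<partial>M) * (\<integral>\<^sup>+x. (ennreal (norm (v x)))\<^sup>2 \<partial>M)"
    by (rule Cauchy_Schwarz_nn_integral) auto
  moreover have "(\<integral>\<^sup>+x. ennreal (norm (u x)) * ennreal (norm (v x)) \<partial>M) = ennreal ?I"
    using i by (simp add: nn_integral_eq_integral flip: ennreal_mult)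
  moreover have "(\<integral>\<^sup>+x. (ennreal (norm (w x)))\<^sup>2 \<partial>M) = ennreal ((L2_norm M w)\<^sup>2)"
    if "square_integrable M w" for w :: "'a \<Rightarrow> 'b"
    using that by (simp add: nn_integral_eq_integral L2_norm_square square_integrable_def ennreal_power)
  ultimately have "ennreal (?I\<^sup>2) \<le> ennreal ((L2_norm M u * L2_norm M v)\<^sup>2)"
    using assms by (simp add: ennreal_power power_mult_distrib flip: ennreal_mult)
  then have "?I\<^sup>2 \<le> (L2_norm M u * L2_norm M v)\<^sup>2" by simp
  then have "?I \<le> L2_norm M u * L2_norm M v"
    by (rule power2_le_imp_le) simp
  moreover have "norm (\<integral>x. u x * v x \<partial>M) \<le> ?I"
    using integral_norm_bound[of M "\<lambda>x. u x * v x"] by (simp add: norm_mult)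
  ultimately show ?thesis by simp
qed

lemma L2_norm_triangle:
  fixes u v :: "'a \<Rightarrow> 'b::{second_countable_topology, real_normed_vector}"
  assumes "square_integrable M u" "square_integrable M v"
  shows "L2_norm M (\<lambda>x. u x + v x) \<le> L2_norm M u + L2_norm M v"
proof -
  note n = square_integrable_norm[OF assms(1)] square_integrable_norm[OF assms(2)]
  have i: "integrable M (\<lambda>x. (norm (u x))\<^sup>2)" "integrable M (\<lambda>x. (norm (v x))\<^sup>2)"
    using assms by (simp_all add: square_integrable_def)
  have j: "integrable M (\<lambda>x. norm (u x) * norm (v x))"
    by (rule square_integrable_imp_integrable_mult[OF n])
  have "(L2_norm M (\<lambda>x. u x + v x))\<^sup>2 \<le> (\<integral>x. (norm (u x))\<^sup>2 + (norm (v x))\<^sup>2 + 2 * (norm (u x) * norm (v x)) \<partial>M)"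
    unfolding L2_norm_square
  proof (rule integral_mono)
    show "integrable M (\<lambda>x. (norm (u x + v x))\<^sup>2)"
      using square_integrable_add[OF assms] by (simp add: square_integrable_def)
    show "(norm (u x + v x))\<^sup>2 \<le> (norm (u x))\<^sup>2 + (norm (v x))\<^sup>2 + 2 * (norm (u x) * norm (v x))" for x
      using power_mono[OF norm_triangle_ineq[of "u x" "v x"], of 2] by (simp add: power2_sum)
  qed (use i j in auto)
  also have "\<dots> = (L2_norm M u)\<^sup>2 + (L2_norm M v)\<^sup>2 + 2 * (\<integral>x. norm (u x) * norm (v x) \<partial>M)"
    using i j by (simp add: L2_norm_square)
  also have "\<dots> \<le> (L2_norm M u)\<^sup>2 + (L2_norm M v)\<^sup>2 + 2 * (L2_norm M u * L2_norm M v)"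
    using L2_Cauchy_Schwarz[OF n] by simp
  also have "\<dots> = (L2_norm M u + L2_norm M v)\<^sup>2" by (simp add: power2_sum)
  finally show ?thesis by (rule power2_le_imp_le) simp
qed

lemma L2_norm_triangle_diff:
  fixes u v w :: "'a \<Rightarrow> 'b::{second_countable_topology, real_normed_vector}"
  assumes "square_integrable M u" "square_integrable M v" "square_integrable M w"
  shows "L2_norm M (\<lambda>x. u x - w x) \<le> L2_norm M (\<lambda>x. u x - v x) + L2_norm M (\<lambda>x. v x - w x)"
  using L2_norm_triangle[of M "\<lambda>x. u x - v x" "\<lambda>x. v x - w x"] assms
  by (simp add: square_integrable_diff)

lemma L2_norm_eq_0_AE:
  assumes "square_integrable M u" "L2_norm M u = 0"
  shows "AE x in M. u x = 0"
proof -
  have "(\<integral>x. (norm (u x))\<^sup>2 \<partial>M) = 0"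
    using assms(2) L2_norm_square[of M u] by simp
  then have "AE x in M. (norm (u x))\<^sup>2 = 0"
    using assms(1) by (subst (asm) integral_nonneg_eq_0_iff_AE) (auto simp: square_integrable_def)
  then show ?thesis by simp
qed

section \<open>Convergence in mean square\<close>

lemma L2_lim_iff:
  "L2_lim M S g \<longleftrightarrow> (\<forall>n. square_integrable M (S n)) \<and> square_integrable M g \<and>
     (\<lambda>n. L2_norm M (\<lambda>x. S n x - g x)) \<longlonglongrightarrow> 0"
proof -
  have "(\<lambda>n. sqrt (a n)) \<longlonglongrightarrow> 0 \<longleftrightarrow> a \<longlonglongrightarrow> 0" if "\<And>n. 0 \<le> a n" for a :: "nat \<Rightarrow> real"
  proof
    assume "(\<lambda>n. sqrt (a n)) \<longlonglongrightarrow> 0"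
    from tendsto_power[OF this, of 2] show "a \<longlonglongrightarrow> 0" using that by simp
  next
    assume "a \<longlonglongrightarrow> 0"
    from tendsto_real_sqrt[OF this] show "(\<lambda>n. sqrt (a n)) \<longlonglongrightarrow> 0" by simp
  qed
  then show ?thesis by (simp add: L2_lim_def L2_norm_def)
qed

lemma L2_limI:
  assumes "\<And>n. square_integrable M (S n)" "square_integrable M g"
    and "\<And>n. L2_norm M (\<lambda>x. S n x - g x) \<le> a n" "a \<longlonglongrightarrow> 0"
  shows "L2_lim M S g"
proof -
  have "(\<lambda>n. L2_norm M (\<lambda>x. S n x - g x)) \<longlonglongrightarrow> 0"
    by (rule Lim_null_comparison[OF _ assms(4)]) (simp add: assms(3))
  then show ?thesis using assms by (simp add: L2_lim_iff)
qed

text \<open>Continuity of the pairing, by Cauchy-Schwarz. This is how Fourier coefficients and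
  covariances of a limit are read off finite sums.\<close>

lemma L2_lim_integral_mult:
  fixes g v :: "'a \<Rightarrow> 'b::{second_countable_topology, real_normed_field, banach}"
  assumes S: "L2_lim M S g" and v: "square_integrable M v"
  shows "(\<lambda>n. \<integral>x. S n x * v x \<partial>M) \<longlonglongrightarrow> (\<integral>x. g x * v x \<partial>M)"
proof (rule LIM_zero_cancel)
  have sq: "square_integrable M (S n)" "square_integrable M g" for n
    using S by (simp_all add: L2_lim_iff)
  have le: "norm ((\<integral>x. S n x * v x \<partial>M) - (\<integral>x. g x * v x \<partial>M)) \<le> L2_norm M (\<lambda>x. S n x - g x) * L2_norm M v" for n
  proof -
    have "(\<integral>x. S n x * v x \<partial>M) - (\<integral>x. g x * v x \<partial>M) = (\<integral>x. (S n x - g x) * v x \<partial>M)"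
      using sq v by (simp add: square_integrable_imp_integrable_mult left_diff_distrib)
    then show ?thesis using L2_Cauchy_Schwarz[OF square_integrable_diff[OF sq] v] by simp
  qed
  have "(\<lambda>n. L2_norm M (\<lambda>x. S n x - g x) * L2_norm M v) \<longlonglongrightarrow> 0"
    using S by (intro tendsto_mult_left_zero) (simp add: L2_lim_iff)
  then show "(\<lambda>n. (\<integral>x. S n x * v x \<partial>M) - (\<integral>x. g x * v x \<partial>M)) \<longlonglongrightarrow> 0"
    by (rule Lim_null_comparison[rotated]) (simp add: le)
qed

lemma L2_lim_norm:
  fixes g :: "'a \<Rightarrow> 'b::{second_countable_topology, real_normed_vector}"
  assumes S: "L2_lim M S g"
  shows "(\<lambda>n. L2_norm M (S n)) \<longlonglongrightarrow> L2_norm M g"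
proof (rule LIM_zero_cancel)
  have sq: "square_integrable M (S n)" "square_integrable M g" for n
    using S by (simp_all add: L2_lim_iff)
  have le: "norm (L2_norm M (S n) - L2_norm M g) \<le> L2_norm M (\<lambda>x. S n x - g x)" for n
    using L2_norm_triangle_diff[of M "S n" g "\<lambda>_. 0"] L2_norm_triangle_diff[of M g "S n" "\<lambda>_. 0"]
      sq(1)[of n] sq(2) L2_norm_minus_commute[of M g "S n"]
    by simp
  have "(\<lambda>n. L2_norm M (\<lambda>x. S n x - g x)) \<longlonglongrightarrow> 0"
    using S by (simp add: L2_lim_iff)
  then show "(\<lambda>n. L2_norm M (S n) - L2_norm M g) \<longlonglongrightarrow> 0"
    by (rule Lim_null_comparison[rotated]) (simp only: le eventually_True)
qed

lemma L2_lim_unique: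
  fixes g :: "'a \<Rightarrow> 'b::{second_countable_topology, real_normed_vector}"
  assumes "L2_lim M S g" "L2_lim M S g'"
  shows "AE x in M. g x = g' x"
proof -
  have sq: "square_integrable M (S n)" "square_integrable M g" "square_integrable M g'" for n
    using assms by (simp_all add: L2_lim_iff)
  have "(\<lambda>n. L2_norm M (\<lambda>x. S n x - g x) + L2_norm M (\<lambda>x. S n x - g' x)) \<longlonglongrightarrow> 0 + 0"
    using assms by (intro tendsto_add) (simp_all add: L2_lim_iff)
  then have "L2_norm M (\<lambda>x. g x - g' x) \<le> 0 + 0"
    using L2_norm_triangle_diff[OF sq(2,1,3)]
    by (intro LIMSEQ_le_const) (auto simp only: L2_norm_minus_commute[of M g "S _"])
  then have "AE x in M. g x - g' x = 0"
    using sq by (intro L2_norm_eq_0_AE square_integrable_diff) (auto intro: antisym)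
  then show ?thesis by simp
qed

lemma L2_lim_bounded_mult:
  fixes g b :: "'a \<Rightarrow> 'b::{second_countable_topology, real_normed_field}"
  assumes S: "L2_lim M S g" and b: "b \<in> borel_measurable M"
    and bB: "AE x in M. norm (b x) \<le> B" and B: "0 \<le> B"
  shows "L2_lim M (\<lambda>n x. b x * S n x) (\<lambda>x. b x * g x)"
proof (rule L2_limI)
  have sq: "square_integrable M (S n)" "square_integrable M g" for n
    using S by (simp_all add: L2_lim_iff)
  show "square_integrable M (\<lambda>x. b x * S n x)" "square_integrable M (\<lambda>x. b x * g x)" for n
    using square_integrable_bounded_mult[OF _ b bB B] sq by auto
  show "L2_norm M (\<lambda>x. b x * S n x - b x * g x) \<le> B * L2_norm M (\<lambda>x. S n x - g x)" for n
    using square_integrable_bounded_mult(2)[OF square_integrable_diff[OF sq] b bB B]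
    by (simp add: right_diff_distrib)
  show "(\<lambda>n. B * L2_norm M (\<lambda>x. S n x - g x)) \<longlonglongrightarrow> 0"
    using S by (intro tendsto_mult_right_zero) (simp add: L2_lim_iff)
qed

lemma L2_lim_diff:
  fixes g g' :: "'a \<Rightarrow> 'b::{second_countable_topology, real_normed_vector}"
  assumes "L2_lim M S g" "L2_lim M S' g'"
  shows "L2_lim M (\<lambda>n x. S n x - S' n x) (\<lambda>x. g x - g' x)"
proof (rule L2_limI)
  have sq: "square_integrable M (S n)" "square_integrable M g"
    "square_integrable M (S' n)" "square_integrable M g'" for n
    using assms by (simp_all add: L2_lim_iff)
  then show "square_integrable M (\<lambda>x. S n x - S' n x)" "square_integrable M (\<lambda>x. g x - g' x)" for n
    by (simp_all add: square_integrable_diff)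
  show "L2_norm M (\<lambda>x. S n x - S' n x - (g x - g' x))
      \<le> L2_norm M (\<lambda>x. S n x - g x) + L2_norm M (\<lambda>x. S' n x - g' x)" for n
  proof -
    have eq: "S n x - S' n x - (g x - g' x) = (S n x - g x) + - (S' n x - g' x)" for x
      by simp
    then show ?thesis
      using L2_norm_triangle[OF square_integrable_diff[OF sq(1,2)]
          square_integrable_uminus[OF square_integrable_diff[OF sq(3,4)]], of n n]
      unfolding L2_norm_uminus by (simp only: eq)
  qed
  show "(\<lambda>n. L2_norm M (\<lambda>x. S n x - g x) + L2_norm M (\<lambda>x. S' n x - g' x)) \<longlonglongrightarrow> 0"
    using assms by (intro tendsto_add_zero) (simp_all add: L2_lim_iff)
qed

lemma L2_lim_cong_AE:
  assumes "L2_lim M S g" "\<And>n. S' n \<in> borel_measurable M" "g' \<in> borel_measurable M"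
    and S: "\<And>n. AE x in M. S n x = S' n x" and g: "AE x in M. g x = g' x"
  shows "L2_lim M S' (g' :: 'a \<Rightarrow> 'b::{second_countable_topology, real_normed_vector})"
proof -
  have m [measurable]: "S n \<in> borel_measurable M" "g \<in> borel_measurable M"
    "S' n \<in> borel_measurable M" "g' \<in> borel_measurable M" for n
    using assms by (simp_all add: L2_lim_iff square_integrable_def)
  have sq: "square_integrable M w" if "square_integrable M v" "AE x in M. v x = w x"
    "w \<in> borel_measurable M" for v w :: "'a \<Rightarrow> 'b"
  proof -
    have [measurable]: "v \<in> borel_measurable M" using that by (simp add: square_integrable_def)
    have "integrable M (\<lambda>x. (norm (v x))\<^sup>2) \<longleftrightarrow> integrable M (\<lambda>x. (norm (w x))\<^sup>2)"
      using that by (intro integrable_cong_AE) auto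
    then show ?thesis using that by (simp add: square_integrable_def)
  qed
  have "L2_norm M (\<lambda>x. S n x - g x) = L2_norm M (\<lambda>x. S' n x - g' x)" for n
    using S[of n] g by (intro L2_norm_cong_AE) auto
  moreover have "square_integrable M (S' n)" for n
    using sq[OF _ S m(3)] assms(1) by (simp add: L2_lim_iff)
  moreover have "square_integrable M g'"
    using sq[OF _ g m(4)] assms(1) by (simp add: L2_lim_iff)
  ultimately show ?thesis
    using assms(1) by (simp add: L2_lim_iff)
qed

section \<open>Completeness of the space of square integrable functions\<close>

lemma (in finite_measure) integral_norm_le_L2_norm:
  fixes u :: "'a \<Rightarrow> 'b::{second_countable_topology, real_normed_vector}"
  assumes "square_integrable M u"
  shows "integrable M (\<lambda>x. norm (u x))"
    and "(\<integral>x. norm (u x) \<partial>M) \<le> L2_norm M u * sqrt (measure M (space M))"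
proof -
  have 1: "square_integrable M (\<lambda>x. 1::real)" by (simp add: square_integrable_def)
  note n = square_integrable_norm[OF assms]
  show "integrable M (\<lambda>x. norm (u x))"
    using square_integrable_imp_integrable_mult[OF n 1] by simp
  show "(\<integral>x. norm (u x) \<partial>M) \<le> L2_norm M u * sqrt (measure M (space M))"
    using L2_Cauchy_Schwarz[OF n 1] by (simp add: L2_norm_def)
qed

text \<open>Cauchy-Schwarz against the constant 1 makes the integrals of the absolute increments
  summable, so the telescoping series converges absolutely at almost every point.\<close>

lemma (in finite_measure) L2_complete_subsequence:
  fixes S :: "nat \<Rightarrow> 'a \<Rightarrow> 'b::{second_countable_topology, banach}"
  assumes S: "\<And>n. square_integrable M (S n)"
    and fast: "\<And>k. L2_norm M (\<lambda>x. S (Suc k) x - S k x) \<le> (1/2) ^ k"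
  shows "AE x in M. convergent (\<lambda>k. S k x)"
proof -
  have [measurable]: "S n \<in> borel_measurable M" for n
    using S by (simp add: square_integrable_def)
  define D where "D k = (\<lambda>x. norm (S (Suc k) x - S k x))" for k
  have [measurable]: "D k \<in> borel_measurable M" for k by (simp add: D_def)
  define C where "C = sqrt (measure M (space M))"
  have le: "(\<integral>\<^sup>+x. ennreal (D k x) \<partial>M) \<le> ennreal (C * (1/2) ^ k)" for k
  proof -
    note d = square_integrable_diff[OF S S, of "Suc k" k]
    have "(\<integral>x. D k x \<partial>M) \<le> L2_norm M (\<lambda>x. S (Suc k) x - S k x) * C"
      using integral_norm_le_L2_norm(2)[OF d] by (simp add: D_def C_def)
    also have "\<dots> \<le> (1/2) ^ k * C"
      by (rule mult_right_mono[OF fast]) (simp add: C_def)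
    finally show ?thesis
      using integral_norm_le_L2_norm(1)[OF d]
      by (subst nn_integral_eq_integral) (auto simp: D_def mult.commute intro!: ennreal_leI)
  qed
  have "(\<integral>\<^sup>+x. (\<Sum>k. ennreal (D k x)) \<partial>M) = (\<Sum>k. \<integral>\<^sup>+x. ennreal (D k x) \<partial>M)"
    by (rule nn_integral_suminf) simp
  also have "\<dots> \<le> (\<Sum>k. ennreal (C * (1/2) ^ k))"
    by (intro suminf_le le) auto
  also have "\<dots> = ennreal (\<Sum>k. C * (1/2) ^ k)"
    by (rule suminf_ennreal2) (auto simp: C_def intro!: summable_mult summable_geometric)
  also have "\<dots> < \<infinity>" by simp
  finally have "AE x in M. (\<Sum>k. ennreal (D k x)) \<noteq> \<infinity>"
    by (intro nn_integral_PInf_AE) auto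
  then show ?thesis
  proof eventually_elim
    case (elim x)
    then have "summable (\<lambda>k. D k x)"
      by (intro summable_suminf_not_top) (auto simp: D_def)
    then have "summable (\<lambda>k. S (Suc k) x - S k x)"
      unfolding D_def by (rule summable_norm_cancel)
    then have "convergent (\<lambda>n. \<Sum>k<n. (S (Suc k) x - S k x))"
      by (simp add: summable_iff_convergent)
    then have "convergent (\<lambda>n. S n x - S 0 x)"
      by (simp only: sum_lessThan_telescope[of "\<lambda>k. S k x"])
    then show ?case
      using convergent_add_const_right_iff[of "\<lambda>n. S n x" "- S 0 x"] by simp
  qed
qed

lemma (in finite_measure) L2_complete:
  fixes S :: "nat \<Rightarrow> 'a \<Rightarrow> 'b::{second_countable_topology, banach}"
  assumes S: "\<And>n. square_integrable M (S n)"
    and Cauchy: "\<And>e. 0 < e \<Longrightarrow> \<exists>N. \<forall>m\<ge>N. \<forall>n\<ge>N. L2_norm M (\<lambda>x. S m x - S n x) \<le> e"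
  shows "\<exists>g. L2_lim M S g"
proof -
  have [measurable]: "S n \<in> borel_measurable M" for n
    using S by (simp add: square_integrable_def)
  have "\<exists>N. \<forall>m\<ge>N. \<forall>n\<ge>N. L2_norm M (\<lambda>x. S m x - S n x) \<le> (1/2) ^ k" for k
    by (rule Cauchy) simp
  then obtain N where N: "\<And>k m n. \<lbrakk>N k \<le> m; N k \<le> n\<rbrakk> \<Longrightarrow> L2_norm M (\<lambda>x. S m x - S n x) \<le> (1/2) ^ k"
    by metis
  \<comment> \<open>Summing the \<open>N i\<close> makes \<open>r (Suc k)\<close> at least
    \<open>N k\<close> as well, so consecutive terms of the subsequence are within
    \<open>(1/2) ^ k\<close>; the summand \<open>k\<close> drives \<open>r\<close> to
    infinity.\<close>
  define r where "r k = (\<Sum>i\<le>k. N i) + k" for k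
  have rN: "N k \<le> r k" "N k \<le> r (Suc k)" "k \<le> r k" for k
  proof -
    have "N k \<le> (\<Sum>i\<le>k. N i)" by (rule member_le_sum) auto
    then show "N k \<le> r k" "N k \<le> r (Suc k)" "k \<le> r k" by (simp_all add: r_def)
  qed
  define g where "g = (\<lambda>x. lim (\<lambda>k. S (r k) x))"
  have [measurable]: "g \<in> borel_measurable M" by (simp add: g_def)
  have conv: "AE x in M. (\<lambda>k. S (r k) x) \<longlonglongrightarrow> g x"
    using L2_complete_subsequence[of "\<lambda>k. S (r k)"] S N rN by (simp add: g_def convergent_LIMSEQ_iff)
  have lim: "square_integrable M (\<lambda>x. S n x - g x) \<and> L2_norm M (\<lambda>x. S n x - g x) \<le> e"
    if e: "0 < e" and n: "n \<ge> K"
      and K: "\<And>m n. \<lbrakk>K \<le> m; K \<le> n\<rbrakk> \<Longrightarrow> L2_norm M (\<lambda>x. S m x - S n x) \<le> e" for e n K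
  proof -
    \<comment> \<open>Fatou: the distance from \<open>S n\<close> to the pointwise limit is at most
      the lower limit of its distances to the subsequence, which are at most \<open>e\<close> from
      index \<open>K\<close> on.\<close>
    have "AE x in M. ennreal ((norm (S n x - g x))\<^sup>2) = liminf (\<lambda>k. ennreal ((norm (S n x - S (r k) x))\<^sup>2))"
      using conv
    proof eventually_elim
      case (elim x)
      then have "(\<lambda>k. ennreal ((norm (S n x - S (r k) x))\<^sup>2)) \<longlonglongrightarrow> ennreal ((norm (S n x - g x))\<^sup>2)"
        by (intro tendsto_intros)
      then show ?case by (intro lim_imp_Liminf[symmetric]) simp
    qed
    then have "(\<integral>\<^sup>+x. ennreal ((norm (S n x - g x))\<^sup>2) \<partial>M)
        = (\<integral>\<^sup>+x. liminf (\<lambda>k. ennreal ((norm (S n x - S (r k) x))\<^sup>2)) \<partial>M)"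
      by (rule nn_integral_cong_AE)
    also have "\<dots> \<le> liminf (\<lambda>k. \<integral>\<^sup>+x. ennreal ((norm (S n x - S (r k) x))\<^sup>2) \<partial>M)"
      by (rule nn_integral_liminf) simp
    also have "\<dots> \<le> liminf (\<lambda>k. ennreal (e\<^sup>2))"
    proof (rule Liminf_mono, rule eventually_mono[OF eventually_ge_at_top[of K]])
      fix k assume "K \<le> k"
      then have "L2_norm M (\<lambda>x. S n x - S (r k) x) \<le> e"
        using n rN(3)[of k] by (intro K) auto
      then have "(L2_norm M (\<lambda>x. S n x - S (r k) x))\<^sup>2 \<le> e\<^sup>2"
        by (intro power_mono) auto
      then show "(\<integral>\<^sup>+x. ennreal ((norm (S n x - S (r k) x))\<^sup>2) \<partial>M) \<le> ennreal (e\<^sup>2)"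
        using square_integrable_diff[OF S S, of n "r k"] unfolding L2_norm_square
        by (subst nn_integral_eq_integral) (auto simp: square_integrable_def intro!: ennreal_leI)
    qed
    finally have le: "(\<integral>\<^sup>+x. ennreal ((norm (S n x - g x))\<^sup>2) \<partial>M) \<le> ennreal (e\<^sup>2)"
      by (simp add: Liminf_const)
    then have int: "integrable M (\<lambda>x. (norm (S n x - g x))\<^sup>2)"
      by (intro integrableI_bounded) (auto intro: le_less_trans)
    have "(L2_norm M (\<lambda>x. S n x - g x))\<^sup>2 \<le> e\<^sup>2"
      using le int unfolding L2_norm_square by (subst (asm) nn_integral_eq_integral) auto
    then have "L2_norm M (\<lambda>x. S n x - g x) \<le> e"
      by (rule power2_le_imp_le) (use e in simp)
    with int show ?thesis by (simp add: square_integrable_def)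
  qed
  have "square_integrable M (\<lambda>x. S (N 0) x - g x)"
    using lim[of 1 "N 0" "N 0"] N[of 0] by simp
  from square_integrable_diff[OF S this, of "N 0"] have g: "square_integrable M g" by simp
  have "(\<lambda>n. L2_norm M (\<lambda>x. S n x - g x)) \<longlonglongrightarrow> 0"
  proof (rule LIMSEQ_I)
    fix e :: real assume "0 < e"
    then obtain K where K: "\<forall>m\<ge>K. \<forall>n\<ge>K. L2_norm M (\<lambda>x. S m x - S n x) \<le> e / 2"
      using Cauchy[of "e / 2"] by auto
    have "L2_norm M (\<lambda>x. S n x - g x) < e" if "n \<ge> K" for n
      using lim[of "e / 2" K n] K that \<open>0 < e\<close> by simp
    then show "\<exists>K. \<forall>n\<ge>K. norm (L2_norm M (\<lambda>x. S n x - g x) - 0) < e"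
      by (intro exI[of _ K]) simp
  qed
  with S g show ?thesis by (auto simp: L2_lim_iff)
qed

section \<open>Fourier series and the Hardy space on the circle\<close>

text \<open>Integer frequencies put a character and its conjugate under one symbol, so that
  multiplication and conjugation become arithmetic on the index.\<close>

definition fourier_char :: "int \<Rightarrow> real \<Rightarrow> complex" where
  "fourier_char k \<omega> = cis (of_int k * \<omega>)"

lemma cis_fourier_char: "cis (real n * \<omega>) = fourier_char (int n) \<omega>"
  by (simp add: fourier_char_def)

lemma fourier_char_0 [simp]: "fourier_char 0 \<omega> = 1"
  by (simp add: fourier_char_def)

lemma fourier_char_mult: "fourier_char j \<omega> * fourier_char k \<omega> = fourier_char (j + k) \<omega>"
  by (simp add: fourier_char_def cis_mult distrib_right)

lemma cnj_fourier_char [simp]: "cnj (fourier_char k \<omega>) = fourier_char (- k) \<omega>"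
  by (simp add: fourier_char_def cis_cnj)

lemma norm_fourier_char [simp]: "norm (fourier_char k \<omega>) = 1"
  by (simp add: fourier_char_def)

interpretation circ: finite_measure circ
  by (rule finite_measureI) (simp add: emeasure_restrict_space)

lemma fourier_char_measurable [measurable]: "fourier_char k \<in> borel_measurable circ"
  unfolding fourier_char_def
  by (rule continuous_imp_measurable_on_sets_lebesgue) (auto intro!: continuous_intros)

lemma square_integrable_fourier_char: "square_integrable circ (fourier_char k)"
  by (simp add: square_integrable_def)

lemma integral_fourier_char:
  "(\<integral>\<omega>. fourier_char k \<omega> \<partial>circ) = (if k = 0 then complex_of_real (2 * pi) else 0)"
proof -
  have "integrable circ (fourier_char k)"
    by (rule circ.integrable_const_bound[where B = 1]) auto
  then have eq: "(\<integral>\<omega>. fourier_char k \<omega> \<partial>circ) = integral {0..<2*pi} (fourier_char k)"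
    by (rule lebesgue_integral_eq_integral) simp
  also have "\<dots> = integral {0..2*pi} (fourier_char k)"
    by (rule integral_spike_set) (auto intro: negligible_subset[of "{2*pi}"])
  also have "\<dots> = (if k = 0 then complex_of_real (2 * pi) else 0)"
  proof (cases "k = 0")
    case True
    then show ?thesis by (simp add: fourier_char_def[abs_def] scaleR_conv_of_real)
  next
    case False
    \<comment> \<open>At a nonzero frequency the antiderivative is again periodic, so it takes the
      same value at both ends.\<close>
    define F where "F \<omega> = fourier_char k \<omega> / (\<i> * of_int k)" for \<omega>
    have "((\<lambda>z. exp (\<i> * of_int k * z) / (\<i> * of_int k)) has_field_derivative exp (\<i> * of_int k * z)) (at z)" for z
      using False by (auto intro!: derivative_eq_intros)
    from has_vector_derivative_real_field[OF this]
    have "(F has_vector_derivative fourier_char k \<omega>) (at \<omega> within {0..2*pi})" for \<omega>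
      by (simp add: F_def[abs_def] fourier_char_def[abs_def] cis_conv_exp mult.assoc)
    then have "(fourier_char k has_integral F (2*pi) - F 0) {0..2*pi}"
      by (intro fundamental_theorem_of_calculus) auto
    moreover have "F (2*pi) = F 0"
      using cis_multiple_2pi[of "of_int k"] by (simp add: F_def fourier_char_def mult.commute)
    ultimately show ?thesis using False by (simp add: integral_unique)
  qed
  finally show ?thesis .
qed

lemma integrable_fourier_char_mult:
  assumes "square_integrable circ u"
  shows "integrable circ (\<lambda>\<omega>. u \<omega> * fourier_char k \<omega>)"
  by (rule square_integrable_imp_integrable_mult[OF assms square_integrable_fourier_char])

lemma square_integrable_trig_poly:
  "square_integrable circ (\<lambda>\<omega>. \<Sum>j\<in>J. a j * fourier_char (k j) \<omega>)"
  by (intro square_integrable_sum square_integrable_cmult square_integrable_fourier_char)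

text \<open>The frequency map \<open>k\<close> is arbitrary so that one computation covers sums over
  naturals, two-sided sums over integers and conjugated sums. It need not be injective: every
  \<open>j\<close> with \<open>k j = - l\<close> contributes.\<close>

lemma integral_trig_poly:
  "(\<integral>\<omega>. (\<Sum>j\<in>J. a j * fourier_char (k j) \<omega>) * fourier_char l \<omega> \<partial>circ)
     = (\<Sum>j\<in>J. a j * (if k j + l = 0 then complex_of_real (2 * pi) else 0))"
proof -
  have "(\<Sum>j\<in>J. a j * fourier_char (k j) \<omega>) * fourier_char l \<omega>
      = (\<Sum>j\<in>J. a j * fourier_char (k j + l) \<omega>)" for \<omega>
    by (simp add: sum_distrib_right fourier_char_mult mult.assoc)
  moreover have "integrable circ (\<lambda>\<omega>. a j * fourier_char (k j + l) \<omega>)" for j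
    by (intro integrable_mult_right circ.integrable_const_bound[where B = 1]) auto
  ultimately show ?thesis by (simp add: integral_fourier_char)
qed

text \<open>Encoded as the closure of the analytic polynomials rather than by vanishing negative
  Fourier coefficients: the arguments below approximate by polynomials, and closedness follows from
  the triangle inequality alone.\<close>

definition hardy_space :: "(real \<Rightarrow> complex) set" where
  "hardy_space = {g. square_integrable circ g \<and>
     (\<forall>e>0. \<exists>n a. L2_norm circ (\<lambda>\<omega>. g \<omega> - (\<Sum>j<n. a j * fourier_char (int j) \<omega>)) < e)}"

lemma hardy_spaceD: "g \<in> hardy_space \<Longrightarrow> square_integrable circ g"
  by (simp add: hardy_space_def)

lemma hardy_spaceE:
  assumes "g \<in> hardy_space" "0 < e"
  obtains n a where "L2_norm circ (\<lambda>\<omega>. g \<omega> - (\<Sum>j<n. a j * fourier_char (int j) \<omega>)) < e"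
  using assms unfolding hardy_space_def by blast

lemma fourier_char_hardy: "fourier_char (int k) \<in> hardy_space"
proof -
  let ?a = "\<lambda>j. if j = k then 1 else 0 :: complex"
  have "(\<Sum>j<Suc k. ?a j * fourier_char (int j) \<omega>) = fourier_char (int k) \<omega>" for \<omega>
    by simp
  then have "L2_norm circ (\<lambda>\<omega>. fourier_char (int k) \<omega> - (\<Sum>j<Suc k. ?a j * fourier_char (int j) \<omega>)) = 0"
    by (simp only: diff_self) (simp add: L2_norm_def)
  then have "\<exists>n a. L2_norm circ (\<lambda>\<omega>. fourier_char (int k) \<omega> - (\<Sum>j<n. a j * fourier_char (int j) \<omega>)) < e"
    if "0 < e" for e
    using that by (intro exI[of _ "Suc k"] exI[of _ ?a]) linarith
  then show ?thesis
    using square_integrable_fourier_char unfolding hardy_space_def by blast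
qed

lemma hardy_limit:
  assumes S: "\<And>n. S n \<in> hardy_space" and lim: "L2_lim circ S g"
  shows "g \<in> hardy_space"
proof -
  have g: "square_integrable circ g" and l: "(\<lambda>n. L2_norm circ (\<lambda>\<omega>. S n \<omega> - g \<omega>)) \<longlonglongrightarrow> 0"
    using lim by (auto simp: L2_lim_iff)
  have "\<exists>n a. L2_norm circ (\<lambda>\<omega>. g \<omega> - (\<Sum>j<n. a j * fourier_char (int j) \<omega>)) < e" if e: "0 < e" for e
  proof -
    obtain m where m: "L2_norm circ (\<lambda>\<omega>. S m \<omega> - g \<omega>) < e / 2"
      using order_tendstoD(2)[OF l half_gt_zero[OF e]] unfolding eventually_sequentially by blast
    obtain n a where n: "L2_norm circ (\<lambda>\<omega>. S m \<omega> - (\<Sum>j<n. a j * fourier_char (int j) \<omega>)) < e / 2"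
      by (rule hardy_spaceE[OF S half_gt_zero[OF e]])
    have "L2_norm circ (\<lambda>\<omega>. g \<omega> - (\<Sum>j<n. a j * fourier_char (int j) \<omega>)) < e"
      using L2_norm_triangle_diff[OF g hardy_spaceD[OF S[of m]] square_integrable_trig_poly, of a int "{..<n}"] m n
      by (simp add: L2_norm_minus_commute[of circ g])
    then show ?thesis by blast
  qed
  with g show ?thesis by (simp add: hardy_space_def)
qed

lemma hardy_add:
  assumes "u \<in> hardy_space" "v \<in> hardy_space"
  shows "(\<lambda>\<omega>. u \<omega> + v \<omega>) \<in> hardy_space"
proof -
  note sq = hardy_spaceD[OF assms(1)] hardy_spaceD[OF assms(2)]
  have "\<exists>n a. L2_norm circ (\<lambda>\<omega>. u \<omega> + v \<omega> - (\<Sum>j<n. a j * fourier_char (int j) \<omega>)) < e" if e: "0 < e" for e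
  proof -
    obtain n a where n: "L2_norm circ (\<lambda>\<omega>. u \<omega> - (\<Sum>j<n. a j * fourier_char (int j) \<omega>)) < e / 2"
      by (rule hardy_spaceE[OF assms(1) half_gt_zero[OF e]])
    obtain m b where m: "L2_norm circ (\<lambda>\<omega>. v \<omega> - (\<Sum>j<m. b j * fourier_char (int j) \<omega>)) < e / 2"
      by (rule hardy_spaceE[OF assms(2) half_gt_zero[OF e]])
    \<comment> \<open>Both coefficient families are padded with zeros to the common length
      \<open>max n m\<close>.\<close>
    define c where "c j = (if j < n then a j else 0) + (if j < m then b j else 0)" for j
    have split: "(\<Sum>j<max n m. (if j < k then d j else 0) * fourier_char (int j) \<omega>)
        = (\<Sum>j<k. d j * fourier_char (int j) \<omega>)" if "k \<le> max n m" for k d \<omega>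
      using that by (intro sum.mono_neutral_cong_right) auto
    have "(\<Sum>j<max n m. c j * fourier_char (int j) \<omega>)
        = (\<Sum>j<n. a j * fourier_char (int j) \<omega>) + (\<Sum>j<m. b j * fourier_char (int j) \<omega>)" for \<omega>
      unfolding c_def distrib_right sum.distrib using split[of n a] split[of m b] by simp
    then have eq: "u \<omega> + v \<omega> - (\<Sum>j<max n m. c j * fourier_char (int j) \<omega>)
        = (u \<omega> - (\<Sum>j<n. a j * fourier_char (int j) \<omega>)) + (v \<omega> - (\<Sum>j<m. b j * fourier_char (int j) \<omega>))" for \<omega>
      by simp
    have "L2_norm circ (\<lambda>\<omega>. u \<omega> + v \<omega> - (\<Sum>j<max n m. c j * fourier_char (int j) \<omega>)) < e"
      unfolding eq
      using L2_norm_triangle[OF square_integrable_diff[OF sq(1) square_integrable_trig_poly]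
          square_integrable_diff[OF sq(2) square_integrable_trig_poly], of a int "{..<n}" b int "{..<m}"] n m
      by simp
    then show ?thesis by blast
  qed
  with sq show ?thesis by (simp add: hardy_space_def square_integrable_add)
qed

lemma hardy_cmult:
  assumes "u \<in> hardy_space"
  shows "(\<lambda>\<omega>. c * u \<omega>) \<in> hardy_space"
proof -
  note sq = hardy_spaceD[OF assms]
  have "\<exists>n a. L2_norm circ (\<lambda>\<omega>. c * u \<omega> - (\<Sum>j<n. a j * fourier_char (int j) \<omega>)) < e" if e: "0 < e" for e
  proof -
    \<comment> \<open>Adding 1 keeps the divisor positive when \<open>c = 0\<close>.\<close>
    have p: "0 < norm c + 1" by (simp add: add_nonneg_pos)
    obtain n a where n: "L2_norm circ (\<lambda>\<omega>. u \<omega> - (\<Sum>j<n. a j * fourier_char (int j) \<omega>)) < e / (norm c + 1)"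
      using hardy_spaceE[OF assms divide_pos_pos[OF e p]] by blast
    have "L2_norm circ (\<lambda>\<omega>. c * (u \<omega> - (\<Sum>j<n. a j * fourier_char (int j) \<omega>)))
        \<le> (norm c + 1) * L2_norm circ (\<lambda>\<omega>. u \<omega> - (\<Sum>j<n. a j * fourier_char (int j) \<omega>))"
      by (rule square_integrable_bounded_mult(2)[OF square_integrable_diff[OF sq square_integrable_trig_poly]])
         auto
    also have "\<dots> < e" using n p by (simp add: pos_less_divide_eq mult.commute)
    finally have "L2_norm circ (\<lambda>\<omega>. c * u \<omega> - (\<Sum>j<n. (c * a j) * fourier_char (int j) \<omega>)) < e"
      by (simp add: right_diff_distrib sum_distrib_left mult.assoc)
    then show ?thesis by (intro exI[of _ n] exI[of _ "\<lambda>j. c * a j"])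
  qed
  with sq show ?thesis by (simp add: hardy_space_def square_integrable_cmult)
qed

lemma hardy_zero: "(\<lambda>\<omega>. 0) \<in> hardy_space"
  using hardy_cmult[OF fourier_char_hardy, of 0] by simp

lemma hardy_sum:
  assumes "\<And>j. j \<in> J \<Longrightarrow> u j \<in> hardy_space"
  shows "(\<lambda>\<omega>. \<Sum>j\<in>J. u j \<omega>) \<in> hardy_space"
  using assms by (induction J rule: infinite_finite_induct) (auto intro: hardy_add hardy_zero)

text \<open>Multiplying by a character preserves norms and moves an analytic polynomial to higher
  frequencies, so approximants of \<open>u\<close> yield approximants of the product.\<close>

lemma hardy_shift:
  assumes "u \<in> hardy_space"
  shows "(\<lambda>\<omega>. fourier_char (int k) \<omega> * u \<omega>) \<in> hardy_space"
proof -
  note sq = hardy_spaceD[OF assms]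
  have "\<exists>v\<in>hardy_space. L2_norm circ (\<lambda>\<omega>. fourier_char (int k) \<omega> * u \<omega> - v \<omega>) \<le> 1 / Suc i" for i
  proof -
    have "0 < 1 / real (Suc i)" by simp
    then obtain n a where n: "L2_norm circ (\<lambda>\<omega>. u \<omega> - (\<Sum>j<n. a j * fourier_char (int j) \<omega>)) < 1 / Suc i"
      by (rule hardy_spaceE[OF assms])
    let ?v = "\<lambda>\<omega>. \<Sum>j<n. a j * fourier_char (int (k + j)) \<omega>"
    have "L2_norm circ (\<lambda>\<omega>. fourier_char (int k) \<omega> * (u \<omega> - (\<Sum>j<n. a j * fourier_char (int j) \<omega>)))
        \<le> 1 * L2_norm circ (\<lambda>\<omega>. u \<omega> - (\<Sum>j<n. a j * fourier_char (int j) \<omega>))"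
      by (rule square_integrable_bounded_mult(2)[OF square_integrable_diff[OF sq square_integrable_trig_poly]])
         auto
    also have "\<dots> \<le> 1 / Suc i" using n by simp
    finally have "L2_norm circ (\<lambda>\<omega>. fourier_char (int k) \<omega> * u \<omega> - ?v \<omega>) \<le> 1 / Suc i"
      by (simp add: right_diff_distrib sum_distrib_left mult.left_commute[of "fourier_char _ _"] fourier_char_mult)
    moreover have "?v \<in> hardy_space"
      by (intro hardy_sum hardy_cmult fourier_char_hardy)
    ultimately show ?thesis by (intro bexI[of _ ?v])
  qed
  then obtain V where V: "\<And>i. V i \<in> hardy_space"
    "\<And>i. L2_norm circ (\<lambda>\<omega>. fourier_char (int k) \<omega> * u \<omega> - V i \<omega>) \<le> 1 / Suc i" by metis
  show ?thesis
  proof (rule hardy_limit[OF V(1)])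
    show "L2_lim circ V (\<lambda>\<omega>. fourier_char (int k) \<omega> * u \<omega>)"
    proof (rule L2_limI)
      show "square_integrable circ (\<lambda>\<omega>. fourier_char (int k) \<omega> * u \<omega>)"
        by (rule square_integrable_bounded_mult(1)[OF sq, where B = 1]) auto
      show "(\<lambda>i. 1 / real (Suc i)) \<longlonglongrightarrow> 0" using LIMSEQ_inverse_real_of_nat by (simp add: inverse_eq_divide)
      show "L2_norm circ (\<lambda>\<omega>. V i \<omega> - fourier_char (int k) \<omega> * u \<omega>) \<le> 1 / real (Suc i)" for i
        using V(2)[of i] by (subst L2_norm_minus_commute) simp
    qed (rule hardy_spaceD[OF V(1)])
  qed
qed

text \<open>The hypothesis says that \<open>R\<close> is the orthogonal projection of \<open>v\<close> onto the Hardy space.\<close>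
lemma hardy_norm_le:
  assumes R: "R \<in> hardy_space" and v: "square_integrable circ v"
    and eq: "\<And>j::nat. (\<integral>\<omega>. (R \<omega> - v \<omega>) * fourier_char (- int j) \<omega> \<partial>circ) = 0"
  shows "L2_norm circ R \<le> L2_norm circ v"
proof -
  note sq = hardy_spaceD[OF R]
  let ?w = "\<lambda>\<omega>. R \<omega> - v \<omega>"
  have w: "square_integrable circ ?w" by (rule square_integrable_diff[OF sq v])
  \<comment> \<open>The hypothesis makes \<open>?w\<close> orthogonal to analytic polynomials only.
    Subtracting a polynomial \<open>?p\<close> close to \<open>R\<close> leaves the pairing
    unchanged, and Cauchy-Schwarz then makes the pairing of \<open>?w\<close> with \<open>R\<close>
    itself arbitrarily small.\<close>
  have "norm (\<integral>\<omega>. ?w \<omega> * cnj (R \<omega>) \<partial>circ) \<le> 0 + e" if e: "0 < e" for e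
  proof -
    have p: "0 < L2_norm circ ?w + 1" by (simp add: add_nonneg_pos)
    obtain n a where n: "L2_norm circ (\<lambda>\<omega>. R \<omega> - (\<Sum>j<n. a j * fourier_char (int j) \<omega>)) < e / (L2_norm circ ?w + 1)"
      using hardy_spaceE[OF R divide_pos_pos[OF e p]] by blast
    let ?p = "\<lambda>\<omega>. \<Sum>j<n. a j * fourier_char (int j) \<omega>"
    have Rp: "square_integrable circ (\<lambda>\<omega>. R \<omega> - ?p \<omega>)"
      by (rule square_integrable_diff[OF sq square_integrable_trig_poly])
    have "(\<integral>\<omega>. ?w \<omega> * cnj (?p \<omega>) \<partial>circ) = (\<integral>\<omega>. (\<Sum>j<n. cnj (a j) * (?w \<omega> * fourier_char (- int j) \<omega>)) \<partial>circ)"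
      by (simp add: sum_distrib_left mult.left_commute)
    also have "\<dots> = 0"
      using eq integrable_fourier_char_mult[OF w] by (subst Bochner_Integration.integral_sum) auto
    finally have "(\<integral>\<omega>. ?w \<omega> * cnj (R \<omega>) \<partial>circ) = (\<integral>\<omega>. ?w \<omega> * cnj (R \<omega>) \<partial>circ) - (\<integral>\<omega>. ?w \<omega> * cnj (?p \<omega>) \<partial>circ)"
      by simp
    also have "\<dots> = (\<integral>\<omega>. ?w \<omega> * cnj (R \<omega>) - ?w \<omega> * cnj (?p \<omega>) \<partial>circ)"
      by (intro Bochner_Integration.integral_diff[symmetric] square_integrable_imp_integrable_mult
          square_integrable_cnj w sq square_integrable_trig_poly)
    also have "\<dots> = (\<integral>\<omega>. ?w \<omega> * cnj (R \<omega> - ?p \<omega>) \<partial>circ)"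
      by (simp only: complex_cnj_diff right_diff_distrib)
    also have "norm \<dots> \<le> L2_norm circ ?w * L2_norm circ (\<lambda>\<omega>. cnj (R \<omega> - ?p \<omega>))"
      by (rule L2_Cauchy_Schwarz[OF w square_integrable_cnj[OF Rp]])
    also have "L2_norm circ (\<lambda>\<omega>. cnj (R \<omega> - ?p \<omega>)) = L2_norm circ (\<lambda>\<omega>. R \<omega> - ?p \<omega>)"
      unfolding L2_norm_def complex_mod_cnj ..
    also have "L2_norm circ ?w * L2_norm circ (\<lambda>\<omega>. R \<omega> - ?p \<omega>) \<le> (L2_norm circ ?w + 1) * (e / (L2_norm circ ?w + 1))"
      using n by (intro mult_mono) auto
    also have "\<dots> = e" using p by simp
    finally show ?thesis by simp
  qed
  then have "norm (\<integral>\<omega>. ?w \<omega> * cnj (R \<omega>) \<partial>circ) \<le> 0" by (rule field_le_epsilon)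
  \<comment> \<open>The squared norm of \<open>R\<close> is thus the inner product of
    \<open>v\<close> with \<open>R\<close>; Cauchy-Schwarz and cancelling one factor
    \<open>L2_norm circ R\<close> finish the proof.\<close>
  then have "(\<integral>\<omega>. R \<omega> * cnj (R \<omega>) \<partial>circ) = (\<integral>\<omega>. v \<omega> * cnj (R \<omega>) \<partial>circ)"
    using sq v by (simp add: left_diff_distrib square_integrable_imp_integrable_mult square_integrable_cnj)
  moreover have "(\<integral>\<omega>. R \<omega> * cnj (R \<omega>) \<partial>circ) = complex_of_real ((L2_norm circ R)\<^sup>2)"
    unfolding L2_norm_square complex_norm_square[symmetric] by (rule integral_complex_of_real)
  ultimately have "(L2_norm circ R)\<^sup>2 = norm (\<integral>\<omega>. v \<omega> * cnj (R \<omega>) \<partial>circ)"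
    by (metis norm_of_real abs_of_nonneg zero_le_power2)
  also have "\<dots> \<le> L2_norm circ v * L2_norm circ (\<lambda>\<omega>. cnj (R \<omega>))"
    by (rule L2_Cauchy_Schwarz[OF v square_integrable_cnj[OF sq]])
  also have "L2_norm circ (\<lambda>\<omega>. cnj (R \<omega>)) = L2_norm circ R"
    unfolding L2_norm_def complex_mod_cnj ..
  finally have "L2_norm circ R * L2_norm circ R \<le> L2_norm circ v * L2_norm circ R"
    by (simp add: power2_eq_square)
  then show ?thesis
    by (cases "L2_norm circ R = 0") (simp_all add: less_le mult_le_cancel_right)
qed

text \<open>Parseval for polynomials, from orthogonality of the characters. For infinite
  \<open>J\<close> both sides are 0, since a sum over an infinite set is 0 by convention.\<close>

lemma L2_norm_trig_poly:
  "(L2_norm circ (\<lambda>\<omega>. \<Sum>j\<in>J. a j * fourier_char (int j) \<omega>))\<^sup>2 = 2 * pi * (\<Sum>j\<in>J. (norm (a j))\<^sup>2)"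
proof (cases "finite J")
  case True
  let ?p = "\<lambda>\<omega>. \<Sum>j\<in>J. a j * fourier_char (int j) \<omega>"
  have "complex_of_real ((L2_norm circ ?p)\<^sup>2) = (\<integral>\<omega>. ?p \<omega> * cnj (?p \<omega>) \<partial>circ)"
    unfolding L2_norm_square complex_norm_square[symmetric] by (rule integral_complex_of_real[symmetric])
  also have "\<dots> = (\<integral>\<omega>. (\<Sum>k\<in>J. cnj (a k) * (?p \<omega> * fourier_char (- int k) \<omega>)) \<partial>circ)"
    by (simp add: sum_distrib_left mult.left_commute)
  also have "\<dots> = (\<Sum>k\<in>J. cnj (a k) * (\<integral>\<omega>. ?p \<omega> * fourier_char (- int k) \<omega> \<partial>circ))"
    by (subst Bochner_Integration.integral_sum)
       (simp_all only: integral_mult_right_zero integrable_mult_right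
          integrable_fourier_char_mult[OF square_integrable_trig_poly])
  also have "\<dots> = (\<Sum>k\<in>J. cnj (a k) * (a k * complex_of_real (2 * pi)))"
    unfolding integral_trig_poly using True
    by (intro sum.cong refl arg_cong2[of _ _ _ _ "(*)"])
       (simp add: if_distrib[of "\<lambda>z. _ * z"] cong: if_cong)
  also have "\<dots> = complex_of_real (2 * pi * (\<Sum>j\<in>J. (norm (a j))\<^sup>2))"
    by (simp add: sum_distrib_left complex_norm_square mult_ac del: of_real_power flip: of_real_power)
  finally show ?thesis by (simp only: of_real_eq_iff)
qed (simp add: L2_norm_def)

text \<open>Every partial sum with \<open>n > k\<close> already has this coefficient, and the limit
  inherits it.\<close>

lemma Fourier_coefficient_of_L2_lim:
  fixes a :: "nat \<Rightarrow> complex"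
  assumes "L2_lim circ (\<lambda>n \<omega>. \<Sum>j<n. a j * fourier_char (int j) \<omega>) g"
  shows "(\<integral>\<omega>. g \<omega> * fourier_char (- int k) \<omega> \<partial>circ) = 2 * pi * a k"
proof -
  have "\<forall>\<^sub>F n in sequentially. (\<integral>\<omega>. (\<Sum>j<n. a j * fourier_char (int j) \<omega>) * fourier_char (- int k) \<omega> \<partial>circ) = 2 * pi * a k"
    using eventually_gt_at_top[of k]
    unfolding integral_trig_poly
    by eventually_elim (simp add: if_distrib[of "\<lambda>z. _ * z"] mult.commute cong: if_cong)
  then show ?thesis
    by (intro LIMSEQ_unique[OF L2_lim_integral_mult[OF assms square_integrable_fourier_char] tendsto_eventually])
qed

text \<open>Riesz-Fischer: by Parseval, the squared norm of a block of the series is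
  \<open>2 * pi\<close> times the corresponding block of a convergent numerical series.\<close>

lemma ex_Fourier_series:
  fixes a :: "nat \<Rightarrow> complex"
  assumes "summable (\<lambda>j. (norm (a j))\<^sup>2)"
  shows "\<exists>g. L2_lim circ (\<lambda>n \<omega>. \<Sum>j<n. a j * fourier_char (int j) \<omega>) g"
proof (rule circ.L2_complete[OF square_integrable_trig_poly])
  fix e :: real assume e: "0 < e"
  let ?P = "\<lambda>n \<omega>. \<Sum>j<n. a j * fourier_char (int j) \<omega>"
  have "0 < e\<^sup>2 / (2 * pi)" using e by simp
  then obtain N where N: "\<And>m n. N \<le> m \<Longrightarrow> norm (\<Sum>j=m..<n. (norm (a j))\<^sup>2) < e\<^sup>2 / (2 * pi)"
    using assms unfolding summable_Cauchy by blast
  have le: "L2_norm circ (\<lambda>\<omega>. ?P n \<omega> - ?P m \<omega>) \<le> e" if "N \<le> m" "m \<le> n" for m n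
  proof -
    have "?P n \<omega> - ?P m \<omega> = (\<Sum>j=m..<n. a j * fourier_char (int j) \<omega>)" for \<omega>
      using sum_diff_nat_ivl[of 0 m n "\<lambda>j. a j * fourier_char (int j) \<omega>"] that by (simp add: atLeast0LessThan)
    then have "(L2_norm circ (\<lambda>\<omega>. ?P n \<omega> - ?P m \<omega>))\<^sup>2 = 2 * pi * (\<Sum>j=m..<n. (norm (a j))\<^sup>2)"
      by (simp add: L2_norm_trig_poly)
    also have "\<dots> \<le> 2 * pi * (e\<^sup>2 / (2 * pi))"
      using N[OF that(1), of n] by (intro mult_left_mono) auto
    also have "\<dots> = e\<^sup>2" by simp
    finally show ?thesis by (rule power2_le_imp_le) (use e in simp)
  qed
  have "L2_norm circ (\<lambda>\<omega>. ?P m \<omega> - ?P n \<omega>) \<le> e" if "N \<le> m" "N \<le> n" for m n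
    using le[of m n] le[of n m] that
    by (cases "m \<le> n") (simp_all add: L2_norm_minus_commute[of circ "?P m" "?P n"])
  then show "\<exists>N. \<forall>m\<ge>N. \<forall>n\<ge>N. L2_norm circ (\<lambda>\<omega>. ?P m \<omega> - ?P n \<omega>) \<le> e" by blast
qed

section \<open>The past of a stationary series\<close>

locale stationary_series = prob_space M for M :: "'a measure" +
  fixes X :: "int \<Rightarrow> 'a \<Rightarrow> real" and f :: "real \<Rightarrow> real" and m K :: real
  assumes stationary: "zero_mean_weakly_stationary M X"
    and density: "spectral_density M X f"
    and bounds: "AE \<omega> in circ. m \<le> f \<omega> \<and> f \<omega> \<le> K" and m: "0 < m" and K: "0 < K"
begin

lemma square_integrable_X: "square_integrable M (X t)"
  using stationary by (simp add: zero_mean_weakly_stationary_def)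

lemma integral_X: "(\<integral>x. X t x \<partial>M) = 0"
  using stationary by (simp add: zero_mean_weakly_stationary_def)

lemma integral_X_mult_X: "(\<integral>x. X j x * X k x \<partial>M) = autocov M X (j - k)"
proof -
  have "covariance M (X j) (X (j - (j - k))) = covariance M (X 0) (X (- (j - k)))"
    using stationary unfolding zero_mean_weakly_stationary_def by blast
  then show ?thesis by (simp add: autocov_def covariance_def integral_X)
qed

text \<open>\<open>Y\<close> may have nonzero mean: that mean only multiplies the mean of
  \<open>X k\<close>, which is 0.\<close>

lemma covariance_X:
  assumes Y: "square_integrable M Y"
  shows "covariance M Y (X k) = (\<integral>x. Y x * X k x \<partial>M)"
proof -
  have 1: "square_integrable M (\<lambda>x. 1::real)" by (simp add: square_integrable_def)
  have "integrable M (X k)"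
    using square_integrable_imp_integrable_mult[OF square_integrable_X 1] by simp
  then show ?thesis
    using square_integrable_imp_integrable_mult[OF Y square_integrable_X]
    by (simp add: covariance_def integral_X left_diff_distrib)
qed

abbreviation past_sum :: "(nat \<Rightarrow> real) \<Rightarrow> nat \<Rightarrow> 'a \<Rightarrow> real" where
  "past_sum a n \<equiv> (\<lambda>x. \<Sum>j<n. a j * X (- int j) x)"

lemma square_integrable_past_sum: "square_integrable M (past_sum a n)"
  by (intro square_integrable_sum square_integrable_cmult square_integrable_X)

lemma integral_past_sum_mult_X:
  "(\<integral>x. past_sum a n x * X (- int k) x \<partial>M) = (\<Sum>j<n. a j * autocov M X (int k - int j))"
  using square_integrable_imp_integrable_mult[OF square_integrable_X square_integrable_X]
  by (simp add: sum_distrib_right mult.assoc integral_X_mult_X)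

section \<open>The density as a multiplier and the norm of finite past sums\<close>

lemma f_measurable [measurable]: "f \<in> borel_measurable circ"
proof -
  have "(\<lambda>\<omega>. complex_of_real (f \<omega>)) \<in> borel_measurable circ"
    using density by (simp add: spectral_density_def L2_lim_def square_integrable_def)
  from measurable_compose[OF this, of Re borel] show ?thesis
    by (simp add: borel_measurable_continuous_onI continuous_on_Re)
qed

lemma norm_f_le: "AE \<omega> in circ. norm (complex_of_real (f \<omega>)) \<le> K"
  using bounds by eventually_elim (use m in auto)

lemma square_integrable_f_mult:
  assumes "square_integrable circ u"
  shows "square_integrable circ (\<lambda>\<omega>. complex_of_real (f \<omega>) * u \<omega>)"
  by (rule square_integrable_bounded_mult(1)[OF assms _ norm_f_le]) (use K in auto)

text \<open>The autocovariances are the Fourier coefficients of the density: its series converges in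
  mean square, and the partial sums with \<open>n \<ge> \<bar>k\<bar>\<close> already contain the
  frequency \<open>k\<close>.\<close>

lemma integral_f_fourier_char:
  "(\<integral>\<omega>. complex_of_real (f \<omega>) * fourier_char (- k) \<omega> \<partial>circ) = 2 * pi * autocov M X k"
proof -
  let ?S = "\<lambda>n \<omega>. \<Sum>r\<in>{- int n..int n}. complex_of_real (autocov M X r) * fourier_char r \<omega>"
  have S: "L2_lim circ ?S (\<lambda>\<omega>. complex_of_real (f \<omega>))"
    using density by (simp add: spectral_density_def fourier_char_def)
  have "\<forall>\<^sub>F n in sequentially. (\<integral>\<omega>. ?S n \<omega> * fourier_char (- k) \<omega> \<partial>circ) = 2 * pi * autocov M X k"
    unfolding integral_trig_poly using eventually_ge_at_top[of "nat \<bar>k\<bar>"]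
  proof eventually_elim
    case (elim n)
    then have "k \<in> {- int n..int n}" by auto
    then show ?case
      by (simp add: if_distrib[of "\<lambda>z. _ * z"] mult.commute cong: if_cong)
  qed
  then show ?thesis
    by (intro LIMSEQ_unique[OF L2_lim_integral_mult[OF S square_integrable_fourier_char] tendsto_eventually])
qed

lemma integral_f_trig_poly:
  "(\<integral>\<omega>. complex_of_real (f \<omega>) * (\<Sum>j<n. a j * fourier_char (int j) \<omega>) * fourier_char (- int k) \<omega> \<partial>circ)
     = 2 * pi * (\<Sum>j<n. a j * autocov M X (int k - int j))"
proof -
  have "complex_of_real (f \<omega>) * (\<Sum>j<n. a j * fourier_char (int j) \<omega>) * fourier_char (- int k) \<omega>
      = (\<Sum>j<n. a j * (complex_of_real (f \<omega>) * fourier_char (- (int k - int j)) \<omega>))" for \<omega>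
    by (simp add: sum_distrib_left sum_distrib_right fourier_char_mult mult_ac)
  moreover have "integrable circ (\<lambda>\<omega>. complex_of_real (f \<omega>) * fourier_char l \<omega>)" for l
    using integrable_fourier_char_mult[OF square_integrable_f_mult[OF square_integrable_fourier_char[of 0]]] by simp
  ultimately have "(\<integral>\<omega>. complex_of_real (f \<omega>) * (\<Sum>j<n. a j * fourier_char (int j) \<omega>) * fourier_char (- int k) \<omega> \<partial>circ)
      = (\<Sum>j<n. a j * (\<integral>\<omega>. complex_of_real (f \<omega>) * fourier_char (- (int k - int j)) \<omega> \<partial>circ))"
    by (simp only: Bochner_Integration.integral_sum integral_mult_right_zero integrable_mult_right)
  then show ?thesis
    by (simp only: integral_f_fourier_char) (simp add: sum_distrib_left mult_ac)
qed

text \<open>The spectral isometry on finite sums: \<open>X (- int j)\<close> corresponds to the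
  character of frequency \<open>j\<close> under the weight \<open>f \<omega> / (2 * pi)\<close>.
  Expanding the squares turns both sides into the same quadratic form in the
  autocovariances.\<close>

lemma past_sum_isometry:
  "2 * pi * (L2_norm M (past_sum a n))\<^sup>2
     = (\<integral>\<omega>. f \<omega> * (norm (\<Sum>j<n. complex_of_real (a j) * fourier_char (int j) \<omega>))\<^sup>2 \<partial>circ)"
proof -
  let ?p = "\<lambda>\<omega>. \<Sum>j<n. complex_of_real (a j) * fourier_char (int j) \<omega>"
  have "(L2_norm M (past_sum a n))\<^sup>2 = (\<integral>x. (\<Sum>k<n. a k * (past_sum a n x * X (- int k) x)) \<partial>M)"
    unfolding L2_norm_square by (simp add: power2_eq_square sum_distrib_left mult_ac)
  also have "\<dots> = (\<Sum>k<n. a k * (\<Sum>j<n. a j * autocov M X (int k - int j)))"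
    using square_integrable_imp_integrable_mult[OF square_integrable_past_sum square_integrable_X]
    by (subst Bochner_Integration.integral_sum) (auto simp: integral_past_sum_mult_X)
  finally have 1: "complex_of_real (2 * pi * (L2_norm M (past_sum a n))\<^sup>2)
      = (\<Sum>k<n. a k * (2 * pi * (\<Sum>j<n. a j * autocov M X (int k - int j))))"
    by (simp add: sum_distrib_left mult_ac)
  have fp: "square_integrable circ (\<lambda>\<omega>. complex_of_real (f \<omega>) * ?p \<omega>)"
    by (rule square_integrable_f_mult[OF square_integrable_trig_poly])
  have expand: "z * cnj (?p \<omega>) = (\<Sum>k<n. a k * (z * fourier_char (- int k) \<omega>))" for z \<omega>
    by (simp add: sum_distrib_left mult.left_commute)
  have "complex_of_real (\<integral>\<omega>. f \<omega> * (norm (?p \<omega>))\<^sup>2 \<partial>circ) = (\<integral>\<omega>. complex_of_real (f \<omega>) * ?p \<omega> * cnj (?p \<omega>) \<partial>circ)"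
    unfolding integral_complex_of_real[symmetric] of_real_mult complex_norm_square mult.assoc ..
  also have "\<dots> = (\<integral>\<omega>. (\<Sum>k<n. a k * (complex_of_real (f \<omega>) * ?p \<omega> * fourier_char (- int k) \<omega>)) \<partial>circ)"
    unfolding expand ..
  also have "\<dots> = (\<Sum>k<n. a k * (2 * pi * (\<Sum>j<n. a j * autocov M X (int k - int j))))"
    using integrable_fourier_char_mult[OF fp]
    by (subst Bochner_Integration.integral_sum) (auto simp: integral_f_trig_poly)
  finally show ?thesis unfolding 1[symmetric] by (simp only: of_real_eq_iff)
qed

text \<open>Replacing the weight by its bounds reduces the isometry to Parseval. In other words, the
  eigenvalues of every Toeplitz section of the autocovariances lie between \<open>m\<close> and
  \<open>K\<close>, so the past variables behave like a Riesz basis.\<close>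

lemma past_sum_norm_bounds:
  "m * (\<Sum>j<n. (a j)\<^sup>2) \<le> (L2_norm M (past_sum a n))\<^sup>2" (is ?lower)
  "(L2_norm M (past_sum a n))\<^sup>2 \<le> K * (\<Sum>j<n. (a j)\<^sup>2)" (is ?upper)
proof -
  let ?p = "\<lambda>\<omega>. \<Sum>j<n. complex_of_real (a j) * fourier_char (int j) \<omega>"
  have sq: "square_integrable circ ?p" by (rule square_integrable_trig_poly)
  then have [measurable]: "?p \<in> borel_measurable circ" and i: "integrable circ (\<lambda>\<omega>. (norm (?p \<omega>))\<^sup>2)"
    by (simp_all only: square_integrable_def)
  have p: "(\<integral>\<omega>. (norm (?p \<omega>))\<^sup>2 \<partial>circ) = 2 * pi * (\<Sum>j<n. (a j)\<^sup>2)"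
    using L2_norm_trig_poly[of "\<lambda>j. complex_of_real (a j)" "{..<n}"] by (simp add: L2_norm_square)
  have fi: "integrable circ (\<lambda>\<omega>. f \<omega> * (norm (?p \<omega>))\<^sup>2)"
  proof (rule Bochner_Integration.integrable_bound)
    show "integrable circ (\<lambda>\<omega>. K * (norm (?p \<omega>))\<^sup>2)" using i by simp
    show "AE \<omega> in circ. norm (f \<omega> * (norm (?p \<omega>))\<^sup>2) \<le> norm (K * (norm (?p \<omega>))\<^sup>2)"
      using bounds by eventually_elim (use m in \<open>auto simp: abs_mult intro!: mult_right_mono\<close>)
  qed simp
  have "(\<integral>\<omega>. m * (norm (?p \<omega>))\<^sup>2 \<partial>circ) \<le> (\<integral>\<omega>. f \<omega> * (norm (?p \<omega>))\<^sup>2 \<partial>circ)"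
  proof (rule integral_mono_AE)
    show "AE \<omega> in circ. m * (norm (?p \<omega>))\<^sup>2 \<le> f \<omega> * (norm (?p \<omega>))\<^sup>2"
      using bounds by eventually_elim (simp add: mult_right_mono)
  qed (use i fi in simp_all)
  then have "2 * pi * (m * (\<Sum>j<n. (a j)\<^sup>2)) \<le> 2 * pi * (L2_norm M (past_sum a n))\<^sup>2"
    unfolding past_sum_isometry by (simp only: integral_mult_right_zero p mult.left_commute[of m])
  then show ?lower by (rule mult_left_le_imp_le) simp
  have "(\<integral>\<omega>. f \<omega> * (norm (?p \<omega>))\<^sup>2 \<partial>circ) \<le> (\<integral>\<omega>. K * (norm (?p \<omega>))\<^sup>2 \<partial>circ)"
  proof (rule integral_mono_AE)
    show "AE \<omega> in circ. f \<omega> * (norm (?p \<omega>))\<^sup>2 \<le> K * (norm (?p \<omega>))\<^sup>2"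
      using bounds by eventually_elim (simp add: mult_right_mono)
  qed (use i fi in simp_all)
  then have "2 * pi * (L2_norm M (past_sum a n))\<^sup>2 \<le> 2 * pi * (K * (\<Sum>j<n. (a j)\<^sup>2))"
    unfolding past_sum_isometry by (simp only: integral_mult_right_zero p mult.left_commute[of K])
  then show ?upper by (rule mult_left_le_imp_le) simp
qed

text \<open>A Bessel inequality by duality: pairing \<open>Y\<close> with the past sum whose
  coefficients are the covariances themselves gives
  \<open>s \<le> L2_norm M Y * sqrt (K * s)\<close>, hence a bound on \<open>s\<close> that does not
  depend on \<open>n\<close>.\<close>

lemma Bessel_summable:
  assumes Y: "square_integrable M Y"
  shows "summable (\<lambda>l. (\<integral>x. Y x * X (- int l) x \<partial>M)\<^sup>2)"
proof (rule summableI_nonneg_bounded)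
  fix n
  define c where "c l = (\<integral>x. Y x * X (- int l) x \<partial>M)" for l
  define s where "s = (\<Sum>l<n. (c l)\<^sup>2)"
  have s: "0 \<le> s" by (simp add: s_def sum_nonneg)
  have "s = (\<Sum>l<n. c l * (\<integral>x. Y x * X (- int l) x \<partial>M))"
    by (simp add: s_def c_def power2_eq_square)
  also have "\<dots> = (\<integral>x. (\<Sum>l<n. c l * (Y x * X (- int l) x)) \<partial>M)"
    by (simp only: Bochner_Integration.integral_sum integral_mult_right_zero integrable_mult_right
        square_integrable_imp_integrable_mult[OF Y square_integrable_X])
  also have "\<dots> = (\<integral>x. Y x * past_sum c n x \<partial>M)"
    by (simp add: sum_distrib_left mult_ac)
  also have "\<dots> \<le> L2_norm M Y * L2_norm M (past_sum c n)"
    using L2_Cauchy_Schwarz[OF Y square_integrable_past_sum, of c n] by simp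
  finally have "s\<^sup>2 \<le> (L2_norm M Y * L2_norm M (past_sum c n))\<^sup>2"
    using s by (intro power_mono)
  also have "\<dots> \<le> (L2_norm M Y)\<^sup>2 * (K * s)"
    unfolding power_mult_distrib s_def by (intro mult_left_mono past_sum_norm_bounds) simp
  finally have "s * s \<le> ((L2_norm M Y)\<^sup>2 * K) * s"
    by (simp add: power2_eq_square mult_ac)
  then have "s \<le> (L2_norm M Y)\<^sup>2 * K"
    using s K by (cases "s = 0") (simp_all add: less_le mult_le_cancel_right)
  then show "(\<Sum>l<n. (\<integral>x. Y x * X (- int l) x \<partial>M)\<^sup>2) \<le> (L2_norm M Y)\<^sup>2 * K"
    by (simp add: s_def c_def)
qed simp

text \<open>Convergence bounds the norms of the partial sums, and the lower estimate passes this
  bound on to the sums of squares.\<close>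

lemma summable_coefficients:
  assumes "L2_lim M (past_sum h) Z"
  shows "summable (\<lambda>j. (h j)\<^sup>2)"
proof -
  have "Bseq (\<lambda>n. L2_norm M (past_sum h n))"
    using L2_lim_norm[OF assms] by (intro convergent_imp_Bseq convergentI)
  then obtain B where B: "\<And>n. L2_norm M (past_sum h n) \<le> B"
    by (auto simp: Bseq_def)
  show ?thesis
  proof (rule summableI_nonneg_bounded)
    fix n
    have "m * (\<Sum>j<n. (h j)\<^sup>2) \<le> (L2_norm M (past_sum h n))\<^sup>2" by (rule past_sum_norm_bounds)
    also have "\<dots> \<le> B\<^sup>2" using B by (intro power_mono) auto
    finally show "(\<Sum>j<n. (h j)\<^sup>2) \<le> B\<^sup>2 / m" using m by (simp add: field_simps)
  qed simp
qed

text \<open>The closed span is defined with arbitrary finite sets of nonpositive indices. Reindexing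
  by \<open>nat (- j)\<close> and padding with zeros gives initial segments; as one sequence
  \<open>a\<close> serves every \<open>n \<ge> N\<close>, two approximants can be compared at a
  common length.\<close>

lemma past_space_approximation:
  assumes Z: "Z \<in> past_space M X" and e: "0 < e"
  shows "\<exists>N a. \<forall>n\<ge>N. L2_norm M (\<lambda>x. Z x - past_sum a n x) < e"
proof -
  have "0 < e\<^sup>2" using e by simp
  then obtain J b where J: "finite J" "J \<subseteq> {..0}"
    and lt: "(\<integral>x. (Z x - (\<Sum>j\<in>J. b j * X j x))\<^sup>2 \<partial>M) < e\<^sup>2"
    using Z unfolding past_space_def by blast
  have inj: "inj_on (\<lambda>j. nat (- j)) J"
  proof (rule inj_onI)
    fix i j assume "i \<in> J" "j \<in> J" "nat (- i) = nat (- j)"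
    moreover from this J(2) have "i \<le> 0" "j \<le> 0" by auto
    ultimately show "i = j" by simp
  qed
  define I where "I = (\<lambda>j. nat (- j)) ` J"
  define a where "a i = (if i \<in> I then b (- int i) else 0)" for i
  have fin: "finite I" using J by (simp add: I_def)
  then obtain N where N: "I \<subseteq> {..<N}"
    by (meson finite_nat_iff_bounded)
  have sum: "(\<Sum>j\<in>J. b j * X j x) = past_sum a n x" if "N \<le> n" for n x
  proof -
    have "(\<Sum>j\<in>J. b j * X j x) = (\<Sum>i\<in>I. b (- int i) * X (- int i) x)"
      unfolding I_def using J(2) by (subst sum.reindex[OF inj]) (auto intro!: sum.cong)
    also have "\<dots> = past_sum a n x"
      using N that by (intro sum.mono_neutral_cong_left) (auto simp: a_def)
    finally show ?thesis .
  qed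
  have "L2_norm M (\<lambda>x. Z x - past_sum a n x) < e" if "N \<le> n" for n
  proof -
    have "(L2_norm M (\<lambda>x. Z x - past_sum a n x))\<^sup>2 < e\<^sup>2"
      using lt sum[OF that] by (simp add: L2_norm_square)
    then show ?thesis by (rule power2_less_imp_less) (use e in simp)
  qed
  then show ?thesis by (intro exI[of _ N] exI[of _ a]) simp
qed

text \<open>The lower bound on the spectral density makes the coefficients of an approximating sequence
  converge; their limits are the coefficients of the expansion.\<close>
lemma ex_past_expansion:
  assumes Z: "Z \<in> past_space M X"
  shows "\<exists>h. L2_lim M (past_sum h) Z"
proof -
  have sqZ: "square_integrable M Z" using Z by (simp add: past_space_def)
  define \<epsilon> where "\<epsilon> i = 1 / real (Suc i)" for i
  have \<epsilon>: "0 < \<epsilon> i" for i by (simp add: \<epsilon>_def)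
  have "\<forall>i. \<exists>p. \<forall>n\<ge>fst p. L2_norm M (\<lambda>x. Z x - past_sum (snd p) n x) < \<epsilon> i"
  proof
    fix i
    obtain N a where "\<forall>n\<ge>N. L2_norm M (\<lambda>x. Z x - past_sum a n x) < \<epsilon> i"
      using past_space_approximation[OF Z \<epsilon>[of i]] by (elim exE)
    then show "\<exists>p. \<forall>n\<ge>fst p. L2_norm M (\<lambda>x. Z x - past_sum (snd p) n x) < \<epsilon> i"
      by (intro exI[of _ "(N, a)"]) simp
  qed
  from choice[OF this] obtain p
    where p: "\<And>i n. fst (p i) \<le> n \<Longrightarrow> L2_norm M (\<lambda>x. Z x - past_sum (snd (p i)) n x) < \<epsilon> i"
    by blast
  define N a where "N i = fst (p i)" and "a i = snd (p i)" for i
  have a: "L2_norm M (\<lambda>x. Z x - past_sum (a i) n x) < \<epsilon> i" if "N i \<le> n" for i n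
    unfolding a_def by (rule p) (use that in \<open>simp add: N_def\<close>)
  have \<epsilon>0: "\<epsilon> \<longlonglongrightarrow> 0"
    using LIMSEQ_inverse_real_of_nat by (simp add: \<epsilon>_def[abs_def] inverse_eq_divide)
  have past_sum_diff: "past_sum u n x - past_sum v n x = past_sum (\<lambda>j. u j - v j) n x" for u v n x
    by (simp add: sum_subtractf left_diff_distrib)
  \<comment> \<open>At a length beyond both \<open>N i\<close> and \<open>N k\<close>, the triangle
    inequality through \<open>Z\<close> bounds the distance of the two approximants, and the lower
    norm estimate turns this into a bound on coefficients.\<close>
  have diff: "m * (\<Sum>j<n. (a i j - a k j)\<^sup>2) \<le> (\<epsilon> i + \<epsilon> k)\<^sup>2" for i k n
  proof -
    define n' where "n' = max n (max (N i) (N k))"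
    have n': "N i \<le> n'" "N k \<le> n'" by (simp_all add: n'_def)
    have "m * (\<Sum>j<n. (a i j - a k j)\<^sup>2) \<le> m * (\<Sum>j<n'. (a i j - a k j)\<^sup>2)"
      using m by (intro mult_left_mono sum_mono2) (auto simp: n'_def)
    also have "\<dots> \<le> (L2_norm M (past_sum (\<lambda>j. a i j - a k j) n'))\<^sup>2"
      by (rule past_sum_norm_bounds)
    also have "\<dots> \<le> (\<epsilon> i + \<epsilon> k)\<^sup>2"
    proof (rule power_mono)
      have "L2_norm M (past_sum (\<lambda>j. a i j - a k j) n')
        \<le> L2_norm M (\<lambda>x. past_sum (a i) n' x - Z x) + L2_norm M (\<lambda>x. Z x - past_sum (a k) n' x)"
      unfolding past_sum_diff[symmetric]
      by (rule L2_norm_triangle_diff[OF square_integrable_past_sum sqZ square_integrable_past_sum])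
    also have "\<dots> \<le> \<epsilon> i + \<epsilon> k"
        using a[OF n'(1)] a[OF n'(2)] unfolding L2_norm_minus_commute[of M "past_sum (a i) n'" Z]
        by linarith
      finally show "L2_norm M (past_sum (\<lambda>j. a i j - a k j) n') \<le> \<epsilon> i + \<epsilon> k" .
    qed simp
    finally show ?thesis .
  qed
  have "Cauchy (\<lambda>i. a i j)" for j
  proof (rule metric_CauchyI)
    fix e :: real assume e: "0 < e"
    \<comment> \<open>A single coefficient difference times \<open>sqrt m\<close> is at most
      \<open>\<epsilon> i + \<epsilon> k\<close>, whence this threshold for each summand.\<close>
    have "0 < sqrt m * e / 2" using e m by simp
    from order_tendstoD(2)[OF \<epsilon>0 this] obtain I where I: "\<And>i. I \<le> i \<Longrightarrow> \<epsilon> i < sqrt m * e / 2"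
      unfolding eventually_sequentially by blast
    have "dist (a i j) (a k j) < e" if "I \<le> i" "I \<le> k" for i k
    proof -
      have "m * (a i j - a k j)\<^sup>2 \<le> m * (\<Sum>j<Suc j. (a i j - a k j)\<^sup>2)"
        using m by (intro mult_left_mono member_le_sum) auto
      also have "\<dots> \<le> (\<epsilon> i + \<epsilon> k)\<^sup>2" by (rule diff)
      also have "\<dots> < (sqrt m * e)\<^sup>2"
        using I[OF that(1)] I[OF that(2)] \<epsilon>[of i] \<epsilon>[of k] by (intro power_strict_mono) auto
      also have "\<dots> = m * e\<^sup>2" using m by (simp add: power_mult_distrib)
      finally have "\<bar>a i j - a k j\<bar>\<^sup>2 < e\<^sup>2" using m by simp
      then show ?thesis using e by (simp only: dist_real_def) (rule power2_less_imp_less, auto)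
    qed
    then show "\<exists>I. \<forall>i\<ge>I. \<forall>k\<ge>I. dist (a i j) (a k j) < e" by blast
  qed
  then have "\<exists>l. (\<lambda>i. a i j) \<longlonglongrightarrow> l" for j
    by (simp add: Cauchy_convergent_iff convergent_def)
  then obtain h where h: "\<And>j. (\<lambda>i. a i j) \<longlonglongrightarrow> h j" by metis
  \<comment> \<open>Only \<open>a k\<close> is sent to its limit; \<open>\<epsilon> k\<close>
    vanishes and the bound stays independent of \<open>n\<close>.\<close>
  have diff_h: "m * (\<Sum>j<n. (a i j - h j)\<^sup>2) \<le> (\<epsilon> i)\<^sup>2" for i n
  proof (rule LIMSEQ_le)
    show "(\<lambda>k. m * (\<Sum>j<n. (a i j - a k j)\<^sup>2)) \<longlonglongrightarrow> m * (\<Sum>j<n. (a i j - h j)\<^sup>2)"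
      by (intro tendsto_intros h)
    show "(\<lambda>k. (\<epsilon> i + \<epsilon> k)\<^sup>2) \<longlonglongrightarrow> (\<epsilon> i)\<^sup>2"
      using tendsto_power[OF tendsto_add[OF tendsto_const \<epsilon>0], of "\<epsilon> i" 2] by simp
  qed (use diff in blast)
  \<comment> \<open>The 1 accounts for the error of the approximant \<open>a i\<close>. Replacing
    \<open>a i\<close> by \<open>h\<close> costs \<open>sqrt (K / m)\<close>: \<open>K\<close> from
    the upper norm estimate and \<open>1 / m\<close> from \<open>diff_h\<close>.\<close>
  have close: "L2_norm M (\<lambda>x. past_sum h n x - Z x) \<le> \<epsilon> i * (1 + sqrt (K / m))" if "N i \<le> n" for i n
  proof -
    have "(L2_norm M (past_sum (\<lambda>j. a i j - h j) n))\<^sup>2 \<le> K * (\<Sum>j<n. (a i j - h j)\<^sup>2)"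
      by (rule past_sum_norm_bounds)
    also have "\<dots> \<le> K * ((\<epsilon> i)\<^sup>2 / m)"
      using diff_h[of i n] m K by (intro mult_left_mono) (auto simp: field_simps)
    also have "\<dots> = (\<epsilon> i * sqrt (K / m))\<^sup>2"
      using m K by (simp add: power_mult_distrib)
    finally have "L2_norm M (past_sum (\<lambda>j. a i j - h j) n) \<le> \<epsilon> i * sqrt (K / m)"
      by (rule power2_le_imp_le) (use \<epsilon>[of i] m K in simp)
    moreover have "L2_norm M (\<lambda>x. Z x - past_sum h n x)
        \<le> L2_norm M (\<lambda>x. Z x - past_sum (a i) n x) + L2_norm M (\<lambda>x. past_sum (a i) n x - past_sum h n x)"
      by (rule L2_norm_triangle_diff[OF sqZ square_integrable_past_sum square_integrable_past_sum])
    ultimately show ?thesis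
      using a[OF that] unfolding past_sum_diff
      by (simp add: L2_norm_minus_commute[of M Z] distrib_left)
  qed
  have "(\<lambda>n. L2_norm M (\<lambda>x. past_sum h n x - Z x)) \<longlonglongrightarrow> 0"
  proof (rule LIMSEQ_I)
    fix e :: real assume e: "0 < e"
    have "(\<lambda>i. \<epsilon> i * (1 + sqrt (K / m))) \<longlonglongrightarrow> 0"
      by (rule tendsto_mult_left_zero[OF \<epsilon>0])
    from order_tendstoD(2)[OF this e] obtain i where i: "\<epsilon> i * (1 + sqrt (K / m)) < e"
      unfolding eventually_sequentially by blast
    show "\<exists>n0. \<forall>n\<ge>n0. norm (L2_norm M (\<lambda>x. past_sum h n x - Z x) - 0) < e"
      using close[of i] i by (intro exI[of _ "N i"]) (auto intro: le_less_trans)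
  qed
  then show ?thesis
    using sqZ square_integrable_past_sum by (auto simp: L2_lim_iff)
qed

section \<open>Projection onto the past and the normal equations\<close>

lemma X_in_past_space: "X (- int l) \<in> past_space M X"
proof -
  have "\<exists>J a. finite J \<and> J \<subseteq> {..0} \<and> (\<integral>x. (X (- int l) x - (\<Sum>j\<in>J. a j * X j x))\<^sup>2 \<partial>M) < e"
    if "0 < e" for e :: real
    using that by (intro exI[of _ "{- int l}"] exI[of _ "\<lambda>_. 1"]) simp
  then show ?thesis by (simp add: past_space_def square_integrable_X)
qed

text \<open>Orthogonality of \<open>Y - PY\<close> to \<open>X (- int k)\<close> lets
  \<open>PY\<close> replace \<open>Y\<close>. Its covariances and the Fourier coefficients of
  \<open>f H\<close> are, up to \<open>2 * pi\<close>, limits of the same finite convolutions of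
  \<open>h\<close> with the autocovariances.\<close>

lemma normal_equations:
  assumes Y: "square_integrable M Y" and proj: "orthogonal_projection M (past_space M X) Y PY"
    and h: "L2_lim M (past_sum h) PY"
    and H: "L2_lim circ (\<lambda>n \<omega>. \<Sum>j<n. complex_of_real (h j) * fourier_char (int j) \<omega>) H"
  shows "(\<integral>\<omega>. complex_of_real (f \<omega>) * H \<omega> * fourier_char (- int k) \<omega> \<partial>circ)
     = 2 * pi * (\<integral>x. Y x * X (- int k) x \<partial>M)"
proof -
  have PY: "square_integrable M PY" using h by (simp add: L2_lim_iff)
  have "(\<integral>x. (Y x - PY x) * X (- int k) x \<partial>M) = 0"
    using proj X_in_past_space by (simp add: orthogonal_projection_def)
  then have eq: "(\<integral>x. Y x * X (- int k) x \<partial>M) = (\<integral>x. PY x * X (- int k) x \<partial>M)"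
    using Y PY square_integrable_X by (simp add: left_diff_distrib square_integrable_imp_integrable_mult)
  have "(\<lambda>n. \<Sum>j<n. h j * autocov M X (int k - int j)) \<longlonglongrightarrow> (\<integral>x. Y x * X (- int k) x \<partial>M)"
    using L2_lim_integral_mult[OF h square_integrable_X[of "- int k"]] unfolding integral_past_sum_mult_X eq .
  then have lim1: "(\<lambda>n. complex_of_real (2 * pi * (\<Sum>j<n. h j * autocov M X (int k - int j))))
      \<longlonglongrightarrow> complex_of_real (2 * pi * (\<integral>x. Y x * X (- int k) x \<partial>M))"
    by (intro tendsto_of_real tendsto_mult tendsto_const)
  have "L2_lim circ (\<lambda>n \<omega>. complex_of_real (f \<omega>) * (\<Sum>j<n. complex_of_real (h j) * fourier_char (int j) \<omega>))
      (\<lambda>\<omega>. complex_of_real (f \<omega>) * H \<omega>)"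
    by (rule L2_lim_bounded_mult[OF H _ norm_f_le]) (use K in auto)
  from L2_lim_integral_mult[OF this square_integrable_fourier_char, of "- int k"]
  have "(\<lambda>n. complex_of_real (2 * pi * (\<Sum>j<n. h j * autocov M X (int k - int j))))
      \<longlonglongrightarrow> (\<integral>\<omega>. complex_of_real (f \<omega>) * H \<omega> * fourier_char (- int k) \<omega> \<partial>circ)"
    unfolding integral_f_trig_poly by simp
  with lim1 show ?thesis by (rule LIMSEQ_unique[symmetric])
qed

end

section \<open>The Wiener-Hopf equation\<close>

lemma L2_lim_cnj:
  fixes g :: "'a \<Rightarrow> complex"
  assumes "L2_lim M S g"
  shows "L2_lim M (\<lambda>n x. cnj (S n x)) (\<lambda>x. cnj (g x))"
  using assms unfolding L2_lim_def complex_cnj_diff[symmetric] complex_mod_cnj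
  by (auto intro: square_integrable_cnj)

lemma L2_lim_ignore_initial_segment: "L2_lim M S g \<Longrightarrow> L2_lim M (\<lambda>n. S (n + k)) g"
  unfolding L2_lim_iff by (auto intro: LIMSEQ_ignore_initial_segment)

lemma L2_lim_const: "square_integrable M g \<Longrightarrow> L2_lim M (\<lambda>n. g) g"
  by (simp add: L2_lim_def)

text \<open>The nonnegative frequency part of the product of \<open>fourier_char l\<close> with the conjugate of \<open>1 - (\<Sum>j\<ge>1. \<phi> j * fourier_char j)\<close>.\<close>
definition filtered_char :: "(nat \<Rightarrow> real) \<Rightarrow> nat \<Rightarrow> real \<Rightarrow> complex" where
  "filtered_char \<phi> l \<omega> = fourier_char (int l) \<omega> - (\<Sum>s=1..l. complex_of_real (\<phi> s) * fourier_char (int (l - s)) \<omega>)"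

lemma filtered_char_hardy: "filtered_char \<phi> l \<in> hardy_space"
proof -
  have "(\<lambda>\<omega>. fourier_char (int l) \<omega> + (\<Sum>s=1..l. complex_of_real (- \<phi> s) * fourier_char (int (l - s)) \<omega>)) \<in> hardy_space"
    by (intro hardy_add hardy_sum hardy_cmult fourier_char_hardy)
  then show ?thesis
    by (simp add: filtered_char_def[abs_def] sum_negf)
qed

text \<open>The term of index \<open>j\<close> in the conjugated series moves to frequency
  \<open>l - j\<close>. Cutting at \<open>j = l\<close> separates a polynomial with nonnegative
  frequencies from a tail with frequencies \<open>- s\<close>, where
  \<open>j = l + s\<close>.\<close>

lemma fourier_char_mult_cnj_filter:
  fixes \<phi> :: "nat \<Rightarrow> real"
  assumes \<phi>: "L2_lim circ (\<lambda>n \<omega>. 1 - (\<Sum>j=1..n. complex_of_real (\<phi> j) * fourier_char (int j) \<omega>)) \<phi>f"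
    and \<phi>l: "L2_lim circ (\<lambda>n \<omega>. \<Sum>s=1..n. complex_of_real (\<phi> (l + s)) * fourier_char (int s) \<omega>) \<phi>l"
  shows "AE \<omega> in circ. fourier_char (int l) \<omega> * cnj (\<phi>f \<omega>) = filtered_char \<phi> l \<omega> - cnj (\<phi>l \<omega>)"
proof (rule L2_lim_unique)
  \<comment> \<open>Truncating at \<open>n + l\<close> instead of \<open>n\<close> lets the tail run
    over exactly \<open>s = 1\<close> to \<open>n\<close>, so that both limits have identical
    partial sums.\<close>
  show "L2_lim circ (\<lambda>n \<omega>. fourier_char (int l) \<omega> * cnj (1 - (\<Sum>j=1..n+l. complex_of_real (\<phi> j) * fourier_char (int j) \<omega>)))
      (\<lambda>\<omega>. fourier_char (int l) \<omega> * cnj (\<phi>f \<omega>))"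
    by (rule L2_lim_bounded_mult[OF L2_lim_cnj[OF L2_lim_ignore_initial_segment[OF \<phi>]], where B = 1]) auto
  have "fourier_char (int l) \<omega> * cnj (1 - (\<Sum>j=1..n+l. complex_of_real (\<phi> j) * fourier_char (int j) \<omega>))
      = filtered_char \<phi> l \<omega> - cnj (\<Sum>s=1..n. complex_of_real (\<phi> (l + s)) * fourier_char (int s) \<omega>)" for n \<omega>
  proof -
    let ?t = "\<lambda>j. complex_of_real (\<phi> j) * fourier_char (int l - int j) \<omega>"
    have "fourier_char (int l) \<omega> * cnj (1 - (\<Sum>j=1..n+l. complex_of_real (\<phi> j) * fourier_char (int j) \<omega>))
        = fourier_char (int l) \<omega> - (\<Sum>j=1..l+n. ?t j)"
      by (simp add: right_diff_distrib sum_distrib_left mult.left_commute fourier_char_mult add.commute)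
    also have "(\<Sum>j=1..l+n. ?t j) = (\<Sum>j=1..l. ?t j) + (\<Sum>j=l+1..l+n. ?t j)"
      by (rule sum.ub_add_nat) simp
    also have "(\<Sum>j=l+1..l+n. ?t j) = (\<Sum>s=1..n. ?t (s + l))"
      using sum.shift_bounds_cl_nat_ivl[of ?t 1 l n] by (simp add: add.commute)
    also have "(\<Sum>j=1..l. ?t j) = (\<Sum>j=1..l. complex_of_real (\<phi> j) * fourier_char (int (l - j)) \<omega>)"
      by (intro sum.cong refl) (simp add: of_nat_diff)
    finally show ?thesis
      by (simp add: filtered_char_def add.commute)
  qed
  then show "L2_lim circ (\<lambda>n \<omega>. fourier_char (int l) \<omega> * cnj (1 - (\<Sum>j=1..n+l. complex_of_real (\<phi> j) * fourier_char (int j) \<omega>)))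
      (\<lambda>\<omega>. filtered_char \<phi> l \<omega> - cnj (\<phi>l \<omega>))"
    by (simp only:) (intro L2_lim_diff L2_lim_const L2_lim_cnj \<phi>l hardy_spaceD filtered_char_hardy)
qed

text \<open>Conjugation leaves only frequencies \<open>- s\<close>; as the series starts at
  \<open>s = 1\<close>, the total frequency \<open>- s - j\<close> is never 0.\<close>

lemma integral_cnj_tail:
  fixes a :: "nat \<Rightarrow> complex"
  assumes "L2_lim circ (\<lambda>n \<omega>. \<Sum>s=1..n. a s * fourier_char (int s) \<omega>) g"
  shows "(\<integral>\<omega>. cnj (g \<omega>) * fourier_char (- int j) \<omega> \<partial>circ) = 0"
proof -
  have "(\<integral>\<omega>. cnj (\<Sum>s=1..n. a s * fourier_char (int s) \<omega>) * fourier_char (- int j) \<omega> \<partial>circ) = 0" for n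
  proof -
    have "(\<integral>\<omega>. cnj (\<Sum>s=1..n. a s * fourier_char (int s) \<omega>) * fourier_char (- int j) \<omega> \<partial>circ)
        = (\<integral>\<omega>. (\<Sum>s=1..n. cnj (a s) * fourier_char (- int s) \<omega>) * fourier_char (- int j) \<omega> \<partial>circ)"
      by simp
    also have "\<dots> = 0"
      unfolding integral_trig_poly by (intro sum.neutral) auto
    finally show ?thesis .
  qed
  then show ?thesis
    using L2_lim_integral_mult[OF L2_lim_cnj[OF assms] square_integrable_fourier_char, of "- int j"]
    by (simp only: LIMSEQ_const_iff)
qed

text \<open>The conjugate of \<open>g\<close> has only nonpositive frequencies, so multiplying by it
  cannot create nonnegative ones from a \<open>w\<close> that has none. Grouping \<open>w\<close>
  with the character makes the integral a pairing of two square integrable functions, continuous in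
  \<open>g\<close>.\<close>

lemma integral_cnj_filter_mult:
  fixes a :: "nat \<Rightarrow> complex"
  assumes lim: "L2_lim circ (\<lambda>n \<omega>. 1 - (\<Sum>s=1..n. a s * fourier_char (int s) \<omega>)) g"
    and w: "square_integrable circ w"
    and w0: "\<And>k::nat. (\<integral>\<omega>. w \<omega> * fourier_char (- int k) \<omega> \<partial>circ) = 0"
  shows "(\<integral>\<omega>. cnj (g \<omega>) * (w \<omega> * fourier_char (- int j) \<omega>) \<partial>circ) = 0"
proof -
  have i: "integrable circ (\<lambda>\<omega>. w \<omega> * fourier_char k \<omega>)" for k
    by (rule integrable_fourier_char_mult[OF w])
  have wj: "square_integrable circ (\<lambda>\<omega>. w \<omega> * fourier_char (- int j) \<omega>)"
    using square_integrable_bounded_mult(1)[OF w fourier_char_measurable, of "- int j" 1] by (simp add: mult.commute)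
  have "(\<integral>\<omega>. cnj (1 - (\<Sum>s=1..n. a s * fourier_char (int s) \<omega>)) * (w \<omega> * fourier_char (- int j) \<omega>) \<partial>circ) = 0" for n
  proof -
    have "cnj (1 - (\<Sum>s=1..n. a s * fourier_char (int s) \<omega>)) * (w \<omega> * fourier_char (- int j) \<omega>)
        = w \<omega> * fourier_char (- int j) \<omega>
          - (\<Sum>s=1..n. cnj (a s) * (w \<omega> * fourier_char (- int (s + j)) \<omega>))" for \<omega>
      by (simp add: left_diff_distrib sum_distrib_right mult.assoc mult.left_commute[of "fourier_char _ _" "w _"]
          fourier_char_mult)
    then have "(\<integral>\<omega>. cnj (1 - (\<Sum>s=1..n. a s * fourier_char (int s) \<omega>)) * (w \<omega> * fourier_char (- int j) \<omega>) \<partial>circ)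
        = (\<integral>\<omega>. w \<omega> * fourier_char (- int j) \<omega> \<partial>circ)
          - (\<Sum>s=1..n. cnj (a s) * (\<integral>\<omega>. w \<omega> * fourier_char (- int (s + j)) \<omega> \<partial>circ))"
      by (simp only: Bochner_Integration.integral_diff Bochner_Integration.integrable_sum
          Bochner_Integration.integral_sum integral_mult_right_zero integrable_mult_right i)
    also have "\<dots> = 0" by (simp only: w0) simp
    finally show ?thesis .
  qed
  then show ?thesis
    using L2_lim_integral_mult[OF L2_lim_cnj[OF lim] wj]
    by (simp only: LIMSEQ_const_iff)
qed

text \<open>The partial sums are the projections onto the Hardy space of \<open>cnj \<phi>f * C\<^sub>n\<close>, where \<open>C\<^sub>n\<close> is a partial
  sum of the Fourier series of the nonnegative frequency part of \<open>G\<close>. The negative frequency part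
  of \<open>G\<close> stays negative after multiplication by \<open>cnj \<phi>f\<close>, so the limit is the projection of
  \<open>cnj \<phi>f * G = T\<close>.\<close>
lemma Wiener_Hopf_expansion:
  fixes c \<phi> :: "nat \<Rightarrow> real"
  assumes \<phi>: "L2_lim circ (\<lambda>n \<omega>. 1 - (\<Sum>j=1..n. complex_of_real (\<phi> j) * fourier_char (int j) \<omega>)) \<phi>f"
    and \<phi>l: "\<And>l. L2_lim circ (\<lambda>n \<omega>. \<Sum>s=1..n. complex_of_real (\<phi> (l + s)) * fourier_char (int s) \<omega>) (\<phi>l l)"
    and B: "AE \<omega> in circ. norm (\<phi>f \<omega>) \<le> B" "0 \<le> B"
    and G: "square_integrable circ G"
    and c: "\<And>k. (\<integral>\<omega>. G \<omega> * fourier_char (- int k) \<omega> \<partial>circ) = 2 * pi * c k"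
    and sum: "summable (\<lambda>l. (c l)\<^sup>2)"
    and T: "T \<in> hardy_space" and TG: "AE \<omega> in circ. T \<omega> = cnj (\<phi>f \<omega>) * G \<omega>"
  shows "L2_lim circ (\<lambda>n \<omega>. \<Sum>l<n. complex_of_real (c l) * filtered_char \<phi> l \<omega>) T"
proof -
  let ?C = "\<lambda>n \<omega>. \<Sum>l<n. complex_of_real (c l) * fourier_char (int l) \<omega>"
  let ?T = "\<lambda>n \<omega>. \<Sum>l<n. complex_of_real (c l) * filtered_char \<phi> l \<omega>"
  obtain Gp where Gp: "L2_lim circ ?C Gp"
    using ex_Fourier_series[of "\<lambda>l. complex_of_real (c l)"] sum by auto
  have sq: "square_integrable circ Gp" "square_integrable circ \<phi>f" "square_integrable circ (\<phi>l l)"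
    "square_integrable circ (?C n)" for l n
    using Gp \<phi> \<phi>l[of l] unfolding L2_lim_iff by blast+
  have T_sq: "square_integrable circ (?T n)" for n
    by (intro hardy_spaceD hardy_sum hardy_cmult filtered_char_hardy)
  note [measurable] = sq(1,2)[THEN square_integrable_measurable] G[THEN square_integrable_measurable]
    hardy_spaceD[OF T, THEN square_integrable_measurable]
  have [measurable]: "?T n \<in> borel_measurable circ" "(\<lambda>\<omega>. cnj (\<phi>l l \<omega>)) \<in> borel_measurable circ" for l n
    by (rule square_integrable_measurable, rule T_sq square_integrable_cnj[OF sq(3)])+
  have cnj_meas [measurable]: "(\<lambda>\<omega>. cnj (\<phi>f \<omega>)) \<in> borel_measurable circ"
    by (rule square_integrable_measurable[OF square_integrable_cnj[OF sq(2)]])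
  have cB: "AE \<omega> in circ. norm (cnj (\<phi>f \<omega>)) \<le> B" using B by simp
  \<comment> \<open>\<open>Gp\<close> carries the coefficients of \<open>G\<close> at nonnegative
    frequencies, so those of \<open>?w\<close> all vanish.\<close>
  let ?w = "\<lambda>\<omega>. G \<omega> - Gp \<omega>"
  have w: "square_integrable circ ?w" by (rule square_integrable_diff[OF G sq(1)])
  have "(\<integral>\<omega>. ?w \<omega> * fourier_char (- int k) \<omega> \<partial>circ) = 0" for k
    using c[of k] Fourier_coefficient_of_L2_lim[OF Gp, of k]
      integrable_fourier_char_mult[OF G] integrable_fourier_char_mult[OF sq(1)]
    by (simp add: left_diff_distrib)
  note w0 = integral_cnj_filter_mult[OF \<phi> w this]
  have t: "AE \<omega> in circ. \<forall>l. fourier_char (int l) \<omega> * cnj (\<phi>f \<omega>) = filtered_char \<phi> l \<omega> - cnj (\<phi>l l \<omega>)"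
    unfolding AE_all_countable using fourier_char_mult_cnj_filter[OF \<phi> \<phi>l] by blast
  have le: "L2_norm circ (\<lambda>\<omega>. ?T n \<omega> - T \<omega>) \<le> B * L2_norm circ (\<lambda>\<omega>. ?C n \<omega> - Gp \<omega>)" for n
  proof -
    \<comment> \<open>\<open>?R\<close> is the error to be bounded and \<open>?v\<close> its
      unprojected counterpart, built from the tail of \<open>Gp\<close>. Once \<open>?R\<close> is
      recognised as the projection of \<open>?v\<close>, \<open>hardy_norm_le\<close> applies, and
      the factor \<open>cnj (\<phi>f \<omega>)\<close> costs \<open>B\<close>.\<close>
    let ?R = "\<lambda>\<omega>. T \<omega> - ?T n \<omega>" and ?v = "\<lambda>\<omega>. cnj (\<phi>f \<omega>) * (Gp \<omega> - ?C n \<omega>)"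
    note d = square_integrable_diff[OF sq(1) sq(4), of n]
    have v: "square_integrable circ ?v"
      by (rule square_integrable_bounded_mult(1)[OF d cnj_meas cB B(2)])
    have v_meas: "?v \<in> borel_measurable circ" using v by (simp only: square_integrable_def)
    have R: "?R \<in> hardy_space"
      using hardy_add[OF T hardy_cmult[of _ "-1"], OF hardy_sum[OF hardy_cmult[OF filtered_char_hardy]]] by simp
    have "(\<integral>\<omega>. (?R \<omega> - ?v \<omega>) * fourier_char (- int j) \<omega> \<partial>circ) = 0" for j
    proof -
      have i1: "integrable circ (\<lambda>\<omega>. cnj (\<phi>f \<omega>) * (?w \<omega> * fourier_char (- int j) \<omega>))"
        using integrable_fourier_char_mult[OF square_integrable_bounded_mult(1)[OF w cnj_meas cB B(2)], of "- int j"]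
        by (simp only: mult.assoc)
      have i2: "integrable circ (\<lambda>\<omega>. cnj (\<phi>l l \<omega>) * fourier_char (- int j) \<omega>)" for l
        by (rule integrable_fourier_char_mult[OF square_integrable_cnj[OF sq(3)]])
      \<comment> \<open>The terms with \<open>?C n\<close> cancel. What remains,
        \<open>cnj (\<phi>f \<omega>) * ?w \<omega>\<close> and the tails
        \<open>cnj (\<phi>l l \<omega>)\<close>, has no coefficient at a nonnegative
        frequency.\<close>
      have "AE \<omega> in circ. (?R \<omega> - ?v \<omega>) * fourier_char (- int j) \<omega>
          = cnj (\<phi>f \<omega>) * (?w \<omega> * fourier_char (- int j) \<omega>)
            - (\<Sum>l<n. complex_of_real (c l) * (cnj (\<phi>l l \<omega>) * fourier_char (- int j) \<omega>))"
        using TG t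
      proof eventually_elim
        case (elim \<omega>)
        have "?T n \<omega> = (\<Sum>l<n. complex_of_real (c l) * (fourier_char (int l) \<omega> * cnj (\<phi>f \<omega>) + cnj (\<phi>l l \<omega>)))"
          using elim(2) by simp
        also have "\<dots> = cnj (\<phi>f \<omega>) * ?C n \<omega> + (\<Sum>l<n. complex_of_real (c l) * cnj (\<phi>l l \<omega>))"
          by (simp add: distrib_left sum.distrib sum_distrib_left mult_ac)
        finally have "?R \<omega> - ?v \<omega> = cnj (\<phi>f \<omega>) * ?w \<omega> - (\<Sum>l<n. complex_of_real (c l) * cnj (\<phi>l l \<omega>))"
          using elim(1) by (simp add: right_diff_distrib)
        then show ?case
          by (simp add: left_diff_distrib sum_distrib_right mult.assoc)
      qed
      then have "(\<integral>\<omega>. (?R \<omega> - ?v \<omega>) * fourier_char (- int j) \<omega> \<partial>circ)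
          = (\<integral>\<omega>. cnj (\<phi>f \<omega>) * (?w \<omega> * fourier_char (- int j) \<omega>)
              - (\<Sum>l<n. complex_of_real (c l) * (cnj (\<phi>l l \<omega>) * fourier_char (- int j) \<omega>)) \<partial>circ)"
        using v_meas by (intro integral_cong_AE) measurable
      also have "\<dots> = 0 - (\<Sum>l<n. complex_of_real (c l) * 0)"
        by (simp only: Bochner_Integration.integral_diff Bochner_Integration.integrable_sum
            Bochner_Integration.integral_sum integral_mult_right_zero integrable_mult_right i1 i2
            w0 integral_cnj_tail[OF \<phi>l])
      finally show ?thesis by simp
    qed
    then have "L2_norm circ ?R \<le> L2_norm circ ?v"
      by (rule hardy_norm_le[OF R v])
    also have "\<dots> \<le> B * L2_norm circ (\<lambda>\<omega>. Gp \<omega> - ?C n \<omega>)"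
      by (rule square_integrable_bounded_mult(2)[OF d cnj_meas cB B(2)])
    finally show ?thesis
      by (simp only: L2_norm_minus_commute[of circ T] L2_norm_minus_commute[of circ Gp])
  qed
  show ?thesis
  proof (rule L2_limI[OF _ _ le])
    show "square_integrable circ (?T n)" for n by (rule T_sq)
    show "(\<lambda>n. B * L2_norm circ (\<lambda>\<omega>. ?C n \<omega> - Gp \<omega>)) \<longlonglongrightarrow> 0"
      using Gp by (intro tendsto_mult_right_zero) (simp add: L2_lim_iff)
  qed (rule hardy_spaceD[OF T])
qed

text \<open>The polynomials approximate \<open>H\<close>, not \<open>g\<close>: approximants of
  \<open>g\<close> converge only in mean square, and their products with \<open>H\<close> need not
  do so. A polynomial times \<open>g\<close> is a combination of shifts of \<open>g\<close>, and
  boundedness of \<open>g\<close> carries the limit.\<close>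

lemma hardy_mult_bounded:
  assumes H: "L2_lim circ (\<lambda>n \<omega>. \<Sum>j<n. a j * fourier_char (int j) \<omega>) H"
    and g: "g \<in> hardy_space" and B: "AE \<omega> in circ. norm (g \<omega>) \<le> B" "0 \<le> B"
  shows "(\<lambda>\<omega>. g \<omega> * H \<omega>) \<in> hardy_space"
proof (rule hardy_limit)
  show "L2_lim circ (\<lambda>n \<omega>. g \<omega> * (\<Sum>j<n. a j * fourier_char (int j) \<omega>)) (\<lambda>\<omega>. g \<omega> * H \<omega>)"
    by (rule L2_lim_bounded_mult[OF H square_integrable_measurable[OF hardy_spaceD[OF g]] B])
  have "(\<lambda>\<omega>. \<Sum>j<n. a j * (fourier_char (int j) \<omega> * g \<omega>)) \<in> hardy_space" for n
    by (intro hardy_sum hardy_cmult hardy_shift g)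
  then show "(\<lambda>\<omega>. g \<omega> * (\<Sum>j<n. a j * fourier_char (int j) \<omega>)) \<in> hardy_space" for n
    by (simp add: sum_distrib_left mult_ac)
qed

text \<open>Each series is expressed as a mean square limit, which \<open>L2_lim_unique\<close>
  determines up to null sets, so the existential quantifiers over \<open>H\<close>, \<open>S\<close>
  and \<open>T\<close> lose nothing. The expansion of \<open>PY\<close> is shown to exist, and the
  formulas are shown for every such expansion.\<close>

theorem theorem2p1:
  fixes M :: "'a measure" and X :: "int \<Rightarrow> 'a \<Rightarrow> real" and Y PY :: "'a \<Rightarrow> real"
    and f :: "real \<Rightarrow> real" and \<sigma>2 :: real and \<psi> \<phi> :: "nat \<Rightarrow> real"
    and \<psi>f \<phi>f :: "real \<Rightarrow> complex" and \<phi>l :: "nat \<Rightarrow> real \<Rightarrow> complex"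
    and cYX :: "nat \<Rightarrow> real"
  assumes "prob_space M"
    and "zero_mean_weakly_stationary M X"
    and "spectral_density M X f"
    and "bounded_away_from_zero_and_infinity f"
    and "spectral_factorization f \<sigma>2 \<psi> \<phi> \<psi>f \<phi>f"
    and "\<And>l. L2_lim circ
           (\<lambda>n \<omega>. \<Sum>s=1..n. complex_of_real (\<phi> (l + s)) * cis (real s * \<omega>)) (\<phi>l l)"
    and "square_integrable M Y"
    and "\<And>l. cYX l = covariance M Y (X (- int l))"
    and "orthogonal_projection M (past_space M X) Y PY"
  shows "summable (\<lambda>l. (cYX l)\<^sup>2) \<and>
    (\<exists>h. L2_lim M (\<lambda>n x. \<Sum>j<n. h j * X (- int j) x) PY) \<and>
    (\<forall>h. L2_lim M (\<lambda>n x. \<Sum>j<n. h j * X (- int j) x) PY \<longrightarrow>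
       summable (\<lambda>j. (h j)\<^sup>2) \<and>
       (\<exists>H S T.
          L2_lim circ (\<lambda>n \<omega>. \<Sum>j<n. complex_of_real (h j) * cis (real j * \<omega>)) H \<and>
          L2_lim circ (\<lambda>n \<omega>. \<Sum>l<n. complex_of_real (cYX l) *
             (cis (real l * \<omega>) + cnj (\<psi>f \<omega>) * cnj (\<phi>l l \<omega>))) S \<and>
          (AE \<omega> in circ. H \<omega> = S \<omega> / complex_of_real (f \<omega>)) \<and>
          L2_lim circ (\<lambda>n \<omega>. \<Sum>l<n. complex_of_real (cYX l) *
             (cis (real l * \<omega>) -
               (\<Sum>s=1..l. complex_of_real (\<phi> s) * cis (real (l - s) * \<omega>)))) T \<and>
          (AE \<omega> in circ. H \<omega> = complex_of_real (inverse \<sigma>2) * \<phi>f \<omega> * T \<omega>)))"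
proof -
  obtain m K0 where m: "0 < m" and bounds0: "AE \<omega> in circ. m \<le> f \<omega> \<and> f \<omega> \<le> K0"
    using assms(4) unfolding bounded_away_from_zero_and_infinity_def by blast
  \<comment> \<open>An upper bound may be enlarged; the maximum with 1 secures positivity.\<close>
  define K where "K = max 1 K0"
  have bounds: "AE \<omega> in circ. m \<le> f \<omega> \<and> f \<omega> \<le> K"
    using bounds0 by eventually_elim (auto simp: K_def)
  interpret prob_space M by (rule assms(1))
  interpret stationary_series M X f m K
    by unfold_locales (use assms(2,3) bounds m in \<open>auto simp: K_def\<close>)
  have \<sigma>2: "0 < \<sigma>2"
    and \<psi>f: "L2_lim circ (\<lambda>n \<omega>. 1 + (\<Sum>j=1..n. complex_of_real (\<psi> j) * fourier_char (int j) \<omega>)) \<psi>f"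
    and \<phi>f: "L2_lim circ (\<lambda>n \<omega>. 1 - (\<Sum>j=1..n. complex_of_real (\<phi> j) * fourier_char (int j) \<omega>)) \<phi>f"
    and inv: "AE \<omega> in circ. \<phi>f \<omega> = inverse (\<psi>f \<omega>)"
    and f\<psi>: "AE \<omega> in circ. f \<omega> = \<sigma>2 * (norm (\<psi>f \<omega>))\<^sup>2"
    using assms(5) unfolding spectral_factorization_def cis_fourier_char by blast+
  have \<phi>l: "L2_lim circ (\<lambda>n \<omega>. \<Sum>s=1..n. complex_of_real (\<phi> (l + s)) * fourier_char (int s) \<omega>) (\<phi>l l)" for l
    using assms(6)[of l] unfolding cis_fourier_char .
  \<comment> \<open>All pointwise identities are collected off one null set; there
    \<open>\<psi>f \<omega>\<close> is nonzero because \<open>f \<omega> \<ge> m > 0\<close>, which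
    justifies the later cancellations.\<close>
  have factor: "AE \<omega> in circ. \<psi>f \<omega> \<noteq> 0 \<and> \<phi>f \<omega> = inverse (\<psi>f \<omega>) \<and> m \<le> f \<omega> \<and> f \<omega> \<le> K \<and>
      complex_of_real (f \<omega>) = complex_of_real \<sigma>2 * \<psi>f \<omega> * cnj (\<psi>f \<omega>)"
    using inv f\<psi> bounds
  proof eventually_elim
    case (elim \<omega>)
    then have "\<psi>f \<omega> \<noteq> 0" using m by auto
    then show ?case using elim by (simp add: complex_norm_square mult.assoc del: of_real_power flip: of_real_power)
  qed
  have \<psi>B: "AE \<omega> in circ. norm (\<psi>f \<omega>) \<le> sqrt (K / \<sigma>2)"
    using f\<psi> bounds
  proof eventually_elim
    case (elim \<omega>)
    then have "(norm (\<psi>f \<omega>))\<^sup>2 \<le> K / \<sigma>2" using \<sigma>2 by (simp add: field_simps)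
    then show ?case by (rule real_le_rsqrt)
  qed
  \<comment> \<open>As \<open>\<phi>f\<close> inverts \<open>\<psi>f\<close>, its squared modulus is
    \<open>\<sigma>2 / f \<omega>\<close>, at most \<open>\<sigma>2 / m\<close>.\<close>
  have \<phi>B: "AE \<omega> in circ. norm (\<phi>f \<omega>) \<le> sqrt (\<sigma>2 / m)"
    using factor f\<psi>
  proof eventually_elim
    case (elim \<omega>)
    then have "m * (norm (\<phi>f \<omega>))\<^sup>2 \<le> \<sigma>2 * (norm (\<psi>f \<omega>))\<^sup>2 * (norm (\<phi>f \<omega>))\<^sup>2"
      by (intro mult_right_mono) auto
    also have "\<dots> = \<sigma>2 * (norm (\<psi>f \<omega>) * norm (\<phi>f \<omega>))\<^sup>2"
      by (simp add: power_mult_distrib)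
    also have "norm (\<psi>f \<omega>) * norm (\<phi>f \<omega>) = 1"
      using elim by (simp add: norm_inverse)
    finally show ?case using m by (intro real_le_rsqrt) (simp add: field_simps)
  qed
  have \<psi>_hardy: "\<psi>f \<in> hardy_space"
  proof (rule hardy_limit[OF _ \<psi>f])
    show "(\<lambda>\<omega>. 1 + (\<Sum>j=1..n. complex_of_real (\<psi> j) * fourier_char (int j) \<omega>)) \<in> hardy_space" for n
      using hardy_add[OF fourier_char_hardy[of 0] hardy_sum[OF hardy_cmult[OF fourier_char_hardy]]] by simp
  qed
  have c: "cYX l = (\<integral>x. Y x * X (- int l) x \<partial>M)" for l
    by (simp add: assms(8) covariance_X[OF assms(7)])
  have c_sum: "summable (\<lambda>l. (cYX l)\<^sup>2)"
    unfolding c by (rule Bessel_summable[OF assms(7)])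
  moreover have "\<exists>h. L2_lim M (past_sum h) PY"
    using assms(9) by (intro ex_past_expansion) (simp add: orthogonal_projection_def)
  moreover have "summable (\<lambda>j. (h j)\<^sup>2) \<and>
       (\<exists>H S T.
          L2_lim circ (\<lambda>n \<omega>. \<Sum>j<n. complex_of_real (h j) * cis (real j * \<omega>)) H \<and>
          L2_lim circ (\<lambda>n \<omega>. \<Sum>l<n. complex_of_real (cYX l) *
             (cis (real l * \<omega>) + cnj (\<psi>f \<omega>) * cnj (\<phi>l l \<omega>))) S \<and>
          (AE \<omega> in circ. H \<omega> = S \<omega> / complex_of_real (f \<omega>)) \<and>
          L2_lim circ (\<lambda>n \<omega>. \<Sum>l<n. complex_of_real (cYX l) *
             (cis (real l * \<omega>) -
               (\<Sum>s=1..l. complex_of_real (\<phi> s) * cis (real (l - s) * \<omega>)))) T \<and>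
          (AE \<omega> in circ. H \<omega> = complex_of_real (inverse \<sigma>2) * \<phi>f \<omega> * T \<omega>))"
    if h: "L2_lim M (past_sum h) PY" for h
  proof -
    have h_sum: "summable (\<lambda>j. (h j)\<^sup>2)" by (rule summable_coefficients[OF h])
    then obtain H where H: "L2_lim circ (\<lambda>n \<omega>. \<Sum>j<n. complex_of_real (h j) * fourier_char (int j) \<omega>) H"
      using ex_Fourier_series[of "\<lambda>j. complex_of_real (h j)"] by auto
    \<comment> \<open>By the factorization \<open>T\<close> equals
      \<open>cnj (\<phi>f \<omega>) * f \<omega> * H \<omega>\<close> and \<open>S\<close> equals
      \<open>f \<omega> * H \<omega>\<close> almost everywhere. The form chosen here shows that
      \<open>T\<close> lies in the Hardy space; the other one is what the expansion needs.\<close>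
    define T where "T \<omega> = complex_of_real \<sigma>2 * (\<psi>f \<omega> * H \<omega>)" for \<omega>
    define S where "S \<omega> = cnj (\<psi>f \<omega>) * T \<omega>" for \<omega>
    have T_hardy: "T \<in> hardy_space"
      unfolding T_def[abs_def]
      by (intro hardy_cmult hardy_mult_bounded[OF H \<psi>_hardy \<psi>B]) (use \<sigma>2 K in simp)
    have T_lim: "L2_lim circ (\<lambda>n \<omega>. \<Sum>l<n. complex_of_real (cYX l) * filtered_char \<phi> l \<omega>) T"
    proof (rule Wiener_Hopf_expansion[OF \<phi>f \<phi>l \<phi>B _ _ _ c_sum T_hardy])
      show "0 \<le> sqrt (\<sigma>2 / m)" using \<sigma>2 m by simp
      show "square_integrable circ (\<lambda>\<omega>. complex_of_real (f \<omega>) * H \<omega>)"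
        using H by (intro square_integrable_f_mult) (simp add: L2_lim_iff)
      show "(\<integral>\<omega>. complex_of_real (f \<omega>) * H \<omega> * fourier_char (- int k) \<omega> \<partial>circ) = 2 * pi * cYX k" for k
        unfolding c by (rule normal_equations[OF assms(7,9) h H])
      show "AE \<omega> in circ. T \<omega> = cnj (\<phi>f \<omega>) * (complex_of_real (f \<omega>) * H \<omega>)"
        using factor by eventually_elim (simp add: T_def)
    qed
    have S_lim: "L2_lim circ (\<lambda>n \<omega>. \<Sum>l<n. complex_of_real (cYX l) *
             (fourier_char (int l) \<omega> + cnj (\<psi>f \<omega>) * cnj (\<phi>l l \<omega>))) S"
    proof (rule L2_lim_cong_AE)
      note [measurable] = square_integrable_measurable[OF square_integrable_cnj[OF hardy_spaceD[OF \<psi>_hardy]]]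
      have [measurable]: "(\<lambda>\<omega>. cnj (\<phi>l l \<omega>)) \<in> borel_measurable circ" for l
        using L2_lim_cnj[OF \<phi>l[of l]] by (intro square_integrable_measurable) (simp add: L2_lim_iff)
      show lim: "L2_lim circ (\<lambda>n \<omega>. cnj (\<psi>f \<omega>) * (\<Sum>l<n. complex_of_real (cYX l) * filtered_char \<phi> l \<omega>)) S"
        unfolding S_def[abs_def]
        by (rule L2_lim_bounded_mult[OF T_lim, where B = "sqrt (K / \<sigma>2)"]) (use \<psi>B \<sigma>2 K in simp_all)
      then show "S \<in> borel_measurable circ"
        by (intro square_integrable_measurable) (simp add: L2_lim_iff)
      show "(\<lambda>\<omega>. \<Sum>l<n. complex_of_real (cYX l) * (fourier_char (int l) \<omega> + cnj (\<psi>f \<omega>) * cnj (\<phi>l l \<omega>)))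
          \<in> borel_measurable circ" for n
        by measurable
      have "AE \<omega> in circ. \<forall>l. fourier_char (int l) \<omega> * cnj (\<phi>f \<omega>) = filtered_char \<phi> l \<omega> - cnj (\<phi>l l \<omega>)"
        unfolding AE_all_countable using fourier_char_mult_cnj_filter[OF \<phi>f \<phi>l] by blast
      then show "AE \<omega> in circ. cnj (\<psi>f \<omega>) * (\<Sum>l<n. complex_of_real (cYX l) * filtered_char \<phi> l \<omega>)
          = (\<Sum>l<n. complex_of_real (cYX l) * (fourier_char (int l) \<omega> + cnj (\<psi>f \<omega>) * cnj (\<phi>l l \<omega>)))" for n
        using factor
      proof eventually_elim
        case (elim \<omega>)
        \<comment> \<open>\<open>cnj (\<psi>f \<omega>)\<close> cancels
          \<open>cnj (\<phi>f \<omega>)\<close>, so the filtered character returns to the plain one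
          plus a correction from the tail.\<close>
        have "cnj (\<psi>f \<omega>) * filtered_char \<phi> l \<omega> = fourier_char (int l) \<omega> + cnj (\<psi>f \<omega>) * cnj (\<phi>l l \<omega>)" for l
        proof -
          have "filtered_char \<phi> l \<omega> = fourier_char (int l) \<omega> * cnj (\<phi>f \<omega>) + cnj (\<phi>l l \<omega>)"
            using elim(1) by simp
          then show ?thesis using elim(2) by (simp add: distrib_left)
        qed
        then show ?case
          by (simp add: sum_distrib_left mult.left_commute[of "cnj (\<psi>f \<omega>)" "complex_of_real _"])
      qed
    qed simp
    have "AE \<omega> in circ. H \<omega> = S \<omega> / complex_of_real (f \<omega>)"
      using factor by eventually_elim (use \<sigma>2 in \<open>simp add: S_def T_def\<close>)
    moreover have "AE \<omega> in circ. H \<omega> = complex_of_real (inverse \<sigma>2) * \<phi>f \<omega> * T \<omega>"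
      using factor by eventually_elim (use \<sigma>2 in \<open>simp add: T_def field_simps\<close>)
    ultimately show ?thesis
      using h_sum H S_lim T_lim unfolding filtered_char_def cis_fourier_char by blast
  qed
  ultimately show ?thesis by blast
qed

end
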